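(* Let $(M,\varphi,\xi,\eta,g)$ be a 3-dimensional $\mathcal{F}_4$-manifold with associated metric $\widetilde g$, and let $(C(t),\mathbf{F}_1)$ be a $\varphi$-slant null curve with respect to $g$, with $a=\eta(\dot C)$ and $b=g(\dot C,\varphi\dot C)=0$, together with its frame $\mathbf{F}_1=\{\dot C,N_1,W_1\}$. Then the curve $C$ with respect to $\widetilde g$ is a $\varphi$-slant spacelike curve in $M$ such that: (i) If $C(t)$ is non-geodesic with respect to $g$, then $C$ is a Frenet curve of osculating order 3 with respect to $\widetilde g$. Let $\widetilde s$ be the arc length parameter of $C(t)$ with respect to $\widetilde g$, $\epsilon=\operatorname{sign}a$, and $\widetilde\epsilon=\operatorname{sign}k_1(t)=\operatorname{sign}\theta(\xi)(t)$, where $k_1(t)$ is the curvature of $(C(t),\mathbf{F}_1)$. The $\widetilde g$-orthonormal vector fields $E_1,E_2,E_3$, the curvature $\widetilde k$ and the torsion $\widetilde\tau$ along $C$ are $$E_1(\widetilde s)=C'(\widetilde s)=\frac{\dot C}{|a|},\qquad \widetilde g(E_1,E_1)=\epsilon_1=1,$$ $$E_2(\widetilde s)=\widetilde\epsilon\left(\frac1a\varphi\dot C-\xi\right)=\widetilde\epsilon\left(-\frac{1}{2a}\dot C-aN_1+W_1\right),\qquad \widetilde g(E_2,E_2)=\epsilon_2=1,$$ $$E_3(\widetilde s)=\frac{1}{|a|}(\varphi\dot C-\dot C)=\epsilon\left(-\frac1a\dot C+W_1\right),\qquad \widetilde g(E_3,E_3)=\epsilon_3=-1,$$ $$\widetilde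 k(\widetilde s)=\frac{|k_1(t)|}{a^2}=\frac{|\theta(\xi)(t)|}{2},\qquad \widetilde\tau(\widetilde s)=\widetilde k(\widetilde s).$$ (ii) If $C(t)$ is a geodesic with respect to $g$, then $C(\widetilde s)$ is also a geodesic with respect to $\widetilde g$.
   Context: A 3-dimensional almost contact B-metric manifold $(M,\varphi,\xi,\eta,g)$ is a smooth 3-manifold with a $(1,1)$-tensor field $\varphi$, a vector field $\xi$, a 1-form $\eta$ and a semi-Riemannian metric $g$ such that $\varphi^2X=-X+\eta(X)\xi$, $\eta(\xi)=1$, and $g(\varphi X,\varphi Y)=-g(X,Y)+\eta(X)\eta(Y)$. Consequently $\eta\circ\varphi=0$, $\varphi\xi=0$, $\eta(X)=g(X,\xi)$, $g(\xi,\xi)=1$, and $g$ has signature $(2,1)$. The associated metric $\widetilde g(X,Y)=g(X,\varphi Y)+\eta(X)\eta(Y)$ is also a B-metric for $(\varphi,\xi,\eta)$, of signature $(2,1)$. Let $\nabla$, $\widetilde\nabla$ be the Levi-Civita connections of $g$, $\widetilde g$. Put $F(X,Y,Z)=g((\nabla_X\varphi)Y,Z)$ and $\theta(X)=g^{ij}F(e_i,e_j,X)$ for a local basis $\{e_i\}$, where $(g^{ij})$ is the inverse of $(g(e_i,e_j))$. $M$ is an $\mathcal{F}_4$-manifold if $$F(X,Y,Z)=-\tfrac{\theta(\xi)}{2}\{g(\varphi X,\varphi Y)\eta(Z)+g(\varphi X,\varphi Z)\eta(Y)\}.$$ It is known that on a 3-dimensional $\mathcal{F}_4$-manifold $\nabla_X\xi=\tfrac{\theta(\xi)}{2}\varphi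 X$ and $\widetilde\nabla_XY-\nabla_XY=\tfrac{\theta(\xi)}{2}\{g(X,\varphi Y)-g(\varphi X,\varphi Y)\}\xi$. Here $\theta(\xi)(t)$ is the function $\theta(\xi)$ evaluated at $C(t)$. A smooth curve $C(t)$ is null for $g$ if $g(\dot C,\dot C)=0$ and $\dot C\neq0$ everywhere. For a B-metric $G\in\{g,\widetilde g\}$, a curve is $\varphi$-slant with respect to $G$ if $G(\dot C,\xi)=\eta(\dot C)$ and $G(\dot C,\varphi\dot C)$ are constant; for non-null curves this is required for the $G$-arc length parameterization. For a $\varphi$-slant null curve in dimension 3 with $a=\eta(\dot C)$, $b=g(\dot C,\varphi\dot C)$, one has $(a,b)\ne(0,0)$, so $b=0$ implies $a\neq0$. For a $\varphi$-slant null curve in a 3-dimensional $\mathcal{F}_4$-manifold, $\mathbf{F}_1=\{\dot C,N_1,W_1\}$ is the frame along $C$ given by $$W_1=-\tfrac{b}{\sqrt{a^4+b^2}}\xi+\tfrac{a}{\sqrt{a^4+b^2}}\varphi\dot C,\qquad N_1=\tfrac{a^3}{a^4+b^2}\xi-\tfrac{a^2}{2(a^4+b^2)}\dot C+\tfrac{b}{a^4+b^2}\varphi\dot C,$$ and $k_1$ is defined by $\nabla_{\dot C}\dot C=k_1W_1$. $C(t)$ is a geodesic with respect to $g$ if $k_1$ vanishes identically; "non-geodesic" means that $k_1$ is nowhere zero along $C$. A unit speed curve $\gamma(\widetilde s)$ for $\widetilde g$ has $\widetilde g(\gamma',\gamma')=\epsilon_1=\pm1$; it is spacelike if $\epsilon_1=1$,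 and a geodesic if $\widetilde\nabla_{\gamma'}\gamma'=0$. It is a Frenet curve of osculating order 3 if there exist orthonormal vector fields $E_1=\gamma',E_2,E_3$ along $\gamma$, with $\widetilde g(E_i,E_i)=\epsilon_i=\pm1$ and $\epsilon_3=-\epsilon_1\epsilon_2$, and positive functions $\widetilde k$ (curvature) and $\widetilde\tau$ (torsion) such that $$\widetilde\nabla_{\gamma'}E_1=\epsilon_2\widetilde kE_2,\quad \widetilde\nabla_{\gamma'}E_2=-\epsilon_1\widetilde kE_1+\epsilon_3\widetilde\tau E_3,\quad \widetilde\nabla_{\gamma'}E_3=-\epsilon_2\widetilde\tau E_2.$$ *)

theory Defs
  imports "HOL-Analysis.Analysis"
begin

section \<open>Smooth maps between normed spaces\<close>

(* Only used for open S (and finite-dimensional domain). *)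
primrec Ck_on :: "nat \<Rightarrow> 'a::real_normed_vector set \<Rightarrow> ('a \<Rightarrow> 'b::real_normed_vector) \<Rightarrow> bool" where
  "Ck_on 0 S f \<longleftrightarrow> continuous_on S f"
| "Ck_on (Suc k) S f \<longleftrightarrow>
     (\<forall>x\<in>S. f differentiable (at x)) \<and> (\<forall>v. Ck_on k S (\<lambda>x. frechet_derivative f (at x) v))"

definition smooth_on :: "'a::real_normed_vector set \<Rightarrow> ('a \<Rightarrow> 'b::real_normed_vector) \<Rightarrow> bool" where
  "smooth_on S f \<longleftrightarrow> (\<forall>k. Ck_on k S f)"

section \<open>Smooth 3-manifolds\<close>

(* The manifold is the whole type 'm. A chart is a pair (domain, coordinate map). *)
type_synonym 'm chart = "'m set \<times> ('m \<Rightarrow> real^3)"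

definition chart_inv :: "'m chart \<Rightarrow> real^3 \<Rightarrow> 'm" where
  "chart_inv c = inv_into (fst c) (snd c)"

definition is_chart :: "'m::topological_space chart \<Rightarrow> bool" where
  "is_chart c \<longleftrightarrow> open (fst c) \<and> open (snd c ` fst c) \<and>
     homeomorphism (fst c) (snd c ` fst c) (snd c) (chart_inv c)"

definition smooth_atlas :: "'m::{t2_space,second_countable_topology} chart set \<Rightarrow> bool" where
  "smooth_atlas A \<longleftrightarrow> (\<forall>c\<in>A. is_chart c) \<and> (\<Union>c\<in>A. fst c) = UNIV \<and>
     (\<forall>c\<in>A. \<forall>d\<in>A. smooth_on (snd c ` (fst c \<inter> fst d)) (snd d \<circ> chart_inv c))"

(* The tangent space at p is identified with real^3 through one chart chosen at p, so that a
   tangent vector at p is the triple of its components in that chart; its components in any other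
   chart c are given by tcoord A c p, and tvec A c p is the inverse map. *)
definition chart_at :: "'m chart set \<Rightarrow> 'm \<Rightarrow> 'm chart" where
  "chart_at A p = (SOME c. c \<in> A \<and> p \<in> fst c)"

definition tcoord :: "'m chart set \<Rightarrow> 'm chart \<Rightarrow> 'm \<Rightarrow> real^3 \<Rightarrow> real^3" where
  "tcoord A c p = frechet_derivative (snd c \<circ> chart_inv (chart_at A p)) (at (snd (chart_at A p) p))"

definition tvec :: "'m chart set \<Rightarrow> 'm chart \<Rightarrow> 'm \<Rightarrow> real^3 \<Rightarrow> real^3" where
  "tvec A c p = frechet_derivative (snd (chart_at A p) \<circ> chart_inv c) (at (snd c p))"

definition coord_frame :: "'m chart set \<Rightarrow> 'm chart \<Rightarrow> 3 \<Rightarrow> 'm \<Rightarrow> real^3" where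
  "coord_frame A c i p = tvec A c p (axis i 1)"

definition smooth_fun_on :: "'m chart set \<Rightarrow> 'm set \<Rightarrow> ('m \<Rightarrow> real) \<Rightarrow> bool" where
  "smooth_fun_on A U f \<longleftrightarrow> (\<forall>c\<in>A. smooth_on (snd c ` (U \<inter> fst c)) (f \<circ> chart_inv c))"

definition smooth_fun_near :: "'m::topological_space chart set \<Rightarrow> 'm \<Rightarrow> ('m \<Rightarrow> real) \<Rightarrow> bool" where
  "smooth_fun_near A p f \<longleftrightarrow> (\<exists>U. open U \<and> p \<in> U \<and> smooth_fun_on A U f)"

definition vfield_on :: "'m chart set \<Rightarrow> 'm set \<Rightarrow> ('m \<Rightarrow> real^3) \<Rightarrow> bool" where
  "vfield_on A U X \<longleftrightarrow>
     (\<forall>c\<in>A. smooth_on (snd c ` (U \<inter> fst c)) ((\<lambda>q. tcoord A c q (X q)) \<circ> chart_inv c))"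

definition vfield_near :: "'m::topological_space chart set \<Rightarrow> 'm \<Rightarrow> ('m \<Rightarrow> real^3) \<Rightarrow> bool" where
  "vfield_near A p X \<longleftrightarrow> (\<exists>U. open U \<and> p \<in> U \<and> vfield_on A U X)"

(* The derivative v(f) of a function f in direction of the tangent vector v at p. *)
definition dir_deriv :: "'m chart set \<Rightarrow> 'm \<Rightarrow> real^3 \<Rightarrow> ('m \<Rightarrow> real) \<Rightarrow> real" where
  "dir_deriv A p v f =
     frechet_derivative (f \<circ> chart_inv (chart_at A p)) (at (snd (chart_at A p) p)) v"

definition is_lie_bracket ::
  "'m::topological_space chart set \<Rightarrow> ('m \<Rightarrow> real^3) \<Rightarrow> ('m \<Rightarrow> real^3) \<Rightarrow> 'm \<Rightarrow> real^3 \<Rightarrow> bool" where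
  "is_lie_bracket A X Y p w \<longleftrightarrow> (\<forall>f. smooth_fun_near A p f \<longrightarrow>
     dir_deriv A p w f = dir_deriv A p (X p) (\<lambda>q. dir_deriv A q (Y q) f)
                       - dir_deriv A p (Y p) (\<lambda>q. dir_deriv A q (X q) f))"

section \<open>Tensor fields and semi-Riemannian metrics\<close>

definition one_form :: "'m chart set \<Rightarrow> ('m \<Rightarrow> real^3 \<Rightarrow> real) \<Rightarrow> bool" where
  "one_form A w \<longleftrightarrow> (\<forall>p. linear (w p)) \<and>
     (\<forall>c\<in>A. \<forall>i. smooth_fun_on A (fst c) (\<lambda>p. w p (coord_frame A c i p)))"

definition tensor11 :: "'m chart set \<Rightarrow> ('m \<Rightarrow> real^3 \<Rightarrow> real^3) \<Rightarrow> bool" where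
  "tensor11 A T \<longleftrightarrow> (\<forall>p. linear (T p)) \<and>
     (\<forall>c\<in>A. \<forall>i. vfield_on A (fst c) (\<lambda>p. T p (coord_frame A c i p)))"

definition tensor02 :: "'m chart set \<Rightarrow> ('m \<Rightarrow> real^3 \<Rightarrow> real^3 \<Rightarrow> real) \<Rightarrow> bool" where
  "tensor02 A B \<longleftrightarrow> (\<forall>p. bilinear (B p)) \<and>
     (\<forall>c\<in>A. \<forall>i j. smooth_fun_on A (fst c)
        (\<lambda>p. B p (coord_frame A c i p) (coord_frame A c j p)))"

definition form_index :: "(real^3 \<Rightarrow> real^3 \<Rightarrow> real) \<Rightarrow> nat" where
  "form_index B = Max {dim S |S. subspace S \<and> (\<forall>v\<in>S. v \<noteq> 0 \<longrightarrow> B v v < 0)}"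

definition semi_riemannian_metric :: "'m chart set \<Rightarrow> ('m \<Rightarrow> real^3 \<Rightarrow> real^3 \<Rightarrow> real) \<Rightarrow> bool" where
  "semi_riemannian_metric A g \<longleftrightarrow> tensor02 A g \<and>
     (\<forall>p x y. g p x y = g p y x) \<and>
     (\<forall>p x. (\<forall>y. g p x y = 0) \<longrightarrow> x = 0) \<and>
     (\<exists>\<nu>. \<forall>p. form_index (g p) = \<nu>)"

section \<open>The Levi-Civita connection\<close>

(* nabla p v Y stands for the covariant derivative at p, in direction of the tangent vector v at p,
   of a vector field Y that is smooth in a neighbourhood of p. *)
type_synonym 'm connection = "'m \<Rightarrow> real^3 \<Rightarrow> ('m \<Rightarrow> real^3) \<Rightarrow> real^3"

definition affine_connection :: "'m::topological_space chart set \<Rightarrow> 'm connection \<Rightarrow> bool" where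
  "affine_connection A nabla \<longleftrightarrow>
     (\<forall>p Y. vfield_near A p Y \<longrightarrow> linear (\<lambda>v. nabla p v Y)) \<and>
     (\<forall>p v Y Z. vfield_near A p Y \<longrightarrow> vfield_near A p Z \<longrightarrow>
        nabla p v (\<lambda>q. Y q + Z q) = nabla p v Y + nabla p v Z) \<and>
     (\<forall>p v f Y. smooth_fun_near A p f \<longrightarrow> vfield_near A p Y \<longrightarrow>
        nabla p v (\<lambda>q. f q *\<^sub>R Y q) = dir_deriv A p v f *\<^sub>R Y p + f p *\<^sub>R nabla p v Y) \<and>
     (\<forall>U X Y. open U \<longrightarrow> vfield_on A U X \<longrightarrow> vfield_on A U Y \<longrightarrow>
        vfield_on A U (\<lambda>q. nabla q (X q) Y))"

definition levi_civita ::
  "'m::topological_space chart set \<Rightarrow> ('m \<Rightarrow> real^3 \<Rightarrow> real^3 \<Rightarrow> real) \<Rightarrow> 'm connection \<Rightarrow> bool" where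
  "levi_civita A g nabla \<longleftrightarrow> affine_connection A nabla \<and>
     (\<forall>p X Y. vfield_near A p X \<longrightarrow> vfield_near A p Y \<longrightarrow>
        is_lie_bracket A X Y p (nabla p (X p) Y - nabla p (Y p) X)) \<and>
     (\<forall>p v Y Z. vfield_near A p Y \<longrightarrow> vfield_near A p Z \<longrightarrow>
        dir_deriv A p v (\<lambda>q. g q (Y q) (Z q)) = g p (nabla p v Y) (Z p) + g p (Y p) (nabla p v Z))"

section \<open>Almost contact B-metric manifolds and the class F4\<close>

definition almost_contact_B_metric ::
  "'m::{t2_space,second_countable_topology} chart set \<Rightarrow> ('m \<Rightarrow> real^3 \<Rightarrow> real^3) \<Rightarrow> ('m \<Rightarrow> real^3) \<Rightarrow>
   ('m \<Rightarrow> real^3 \<Rightarrow> real) \<Rightarrow> ('m \<Rightarrow> real^3 \<Rightarrow> real^3 \<Rightarrow> real) \<Rightarrow> bool" where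
  "almost_contact_B_metric A \<phi> \<xi> \<eta> g \<longleftrightarrow> smooth_atlas A \<and>
     tensor11 A \<phi> \<and> vfield_on A UNIV \<xi> \<and> one_form A \<eta> \<and> semi_riemannian_metric A g \<and>
     (\<forall>p x. \<phi> p (\<phi> p x) = - x + \<eta> p x *\<^sub>R \<xi> p) \<and>
     (\<forall>p. \<eta> p (\<xi> p) = 1) \<and>
     (\<forall>p x y. g p (\<phi> p x) (\<phi> p y) = - g p x y + \<eta> p x * \<eta> p y)"

definition assoc_metric ::
  "('m \<Rightarrow> real^3 \<Rightarrow> real^3) \<Rightarrow> ('m \<Rightarrow> real^3 \<Rightarrow> real) \<Rightarrow> ('m \<Rightarrow> real^3 \<Rightarrow> real^3 \<Rightarrow> real) \<Rightarrow>
   'm \<Rightarrow> real^3 \<Rightarrow> real^3 \<Rightarrow> real" where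
  "assoc_metric \<phi> \<eta> g p x y = g p x (\<phi> p y) + \<eta> p x * \<eta> p y"

(* F(x,Y,z) at p, for tangent vectors x, z at p and a vector field Y near p. *)
definition F_tensor ::
  "('m \<Rightarrow> real^3 \<Rightarrow> real^3) \<Rightarrow> ('m \<Rightarrow> real^3 \<Rightarrow> real^3 \<Rightarrow> real) \<Rightarrow> 'm connection \<Rightarrow>
   'm \<Rightarrow> real^3 \<Rightarrow> ('m \<Rightarrow> real^3) \<Rightarrow> real^3 \<Rightarrow> real" where
  "F_tensor \<phi> g nabla p x Y z = g p (nabla p x (\<lambda>q. \<phi> q (Y q)) - \<phi> p (nabla p x Y)) z"

(* The trace does not depend on the local basis; the coordinate basis of the chart at p is used. *)
definition theta ::
  "'m chart set \<Rightarrow> ('m \<Rightarrow> real^3 \<Rightarrow> real^3) \<Rightarrow> ('m \<Rightarrow> real^3 \<Rightarrow> real^3 \<Rightarrow> real) \<Rightarrow> 'm connection \<Rightarrow>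
   'm \<Rightarrow> real^3 \<Rightarrow> real" where
  "theta A \<phi> g nabla p z =
     (let e = coord_frame A (chart_at A p);
          h = matrix_inv (\<chi> i j. g p (e i p) (e j p))
      in \<Sum>i\<in>UNIV. \<Sum>j\<in>UNIV. h $ i $ j * F_tensor \<phi> g nabla p (e i p) (e j) z)"

definition F4_manifold ::
  "'m::{t2_space,second_countable_topology} chart set \<Rightarrow> ('m \<Rightarrow> real^3 \<Rightarrow> real^3) \<Rightarrow> ('m \<Rightarrow> real^3) \<Rightarrow>
   ('m \<Rightarrow> real^3 \<Rightarrow> real) \<Rightarrow> ('m \<Rightarrow> real^3 \<Rightarrow> real^3 \<Rightarrow> real) \<Rightarrow> 'm connection \<Rightarrow> bool" where
  "F4_manifold A \<phi> \<xi> \<eta> g nabla \<longleftrightarrow>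
     almost_contact_B_metric A \<phi> \<xi> \<eta> g \<and> levi_civita A g nabla \<and>
     (\<forall>p x Y z. vfield_near A p Y \<longrightarrow>
        F_tensor \<phi> g nabla p x Y z =
          - (theta A \<phi> g nabla p (\<xi> p) / 2) *
            (g p (\<phi> p x) (\<phi> p (Y p)) * \<eta> p z + g p (\<phi> p x) (\<phi> p z) * \<eta> p (Y p)))"

section \<open>Curves\<close>

definition smooth_curve :: "'m::topological_space chart set \<Rightarrow> (real \<Rightarrow> 'm) \<Rightarrow> real set \<Rightarrow> bool" where
  "smooth_curve A C I \<longleftrightarrow> open I \<and> is_interval I \<and> I \<noteq> {} \<and> continuous_on I C \<and>
     (\<forall>c\<in>A. smooth_on {t \<in> I. C t \<in> fst c} (snd c \<circ> C))"

definition velocity :: "'m chart set \<Rightarrow> (real \<Rightarrow> 'm) \<Rightarrow> real \<Rightarrow> real^3" where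
  "velocity A C t = vector_derivative (snd (chart_at A (C t)) \<circ> C) (at t)"

definition vfield_along :: "'m chart set \<Rightarrow> (real \<Rightarrow> 'm) \<Rightarrow> real set \<Rightarrow> (real \<Rightarrow> real^3) \<Rightarrow> bool" where
  "vfield_along A C I V \<longleftrightarrow>
     (\<forall>c\<in>A. smooth_on {t \<in> I. C t \<in> fst c} (\<lambda>s. tcoord A c (C s) (V s)))"

(* Covariant derivative of V along C: writing V as a combination of v_i and the coordinate fields
   e_i near C t, it is the sum over i of v_i' e_i + v_i nabla_{C'} e_i. *)
definition cov_deriv_along ::
  "'m chart set \<Rightarrow> 'm connection \<Rightarrow> (real \<Rightarrow> 'm) \<Rightarrow> (real \<Rightarrow> real^3) \<Rightarrow> real \<Rightarrow> real^3" where
  "cov_deriv_along A nabla C V t =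
     (let c = chart_at A (C t);
          e = coord_frame A c;
          v = (\<lambda>s. tcoord A c (C s) (V s))
      in \<Sum>i\<in>UNIV. deriv (\<lambda>s. v s $ i) t *\<^sub>R e i (C t)
                   + v t $ i *\<^sub>R nabla (C t) (velocity A C t) (e i))"

definition geodesic :: "'m chart set \<Rightarrow> 'm connection \<Rightarrow> (real \<Rightarrow> 'm) \<Rightarrow> real set \<Rightarrow> bool" where
  "geodesic A nabla C I \<longleftrightarrow> (\<forall>t\<in>I. cov_deriv_along A nabla C (velocity A C) t = 0)"

definition null_curve ::
  "'m chart set \<Rightarrow> ('m \<Rightarrow> real^3 \<Rightarrow> real^3 \<Rightarrow> real) \<Rightarrow> (real \<Rightarrow> 'm) \<Rightarrow> real set \<Rightarrow> bool" where
  "null_curve A G C I \<longleftrightarrow>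
     (\<forall>t\<in>I. G (C t) (velocity A C t) (velocity A C t) = 0 \<and> velocity A C t \<noteq> 0)"

definition unit_speed ::
  "'m chart set \<Rightarrow> ('m \<Rightarrow> real^3 \<Rightarrow> real^3 \<Rightarrow> real) \<Rightarrow> (real \<Rightarrow> 'm) \<Rightarrow> real set \<Rightarrow> real \<Rightarrow> bool" where
  "unit_speed A G C I \<epsilon>1 \<longleftrightarrow> \<epsilon>1 \<in> {1, -1} \<and>
     (\<forall>t\<in>I. G (C t) (velocity A C t) (velocity A C t) = \<epsilon>1)"

(* Arc length is determined up to an additive constant. *)
definition arc_length_parameter ::
  "'m chart set \<Rightarrow> ('m \<Rightarrow> real^3 \<Rightarrow> real^3 \<Rightarrow> real) \<Rightarrow> (real \<Rightarrow> 'm) \<Rightarrow> real set \<Rightarrow> (real \<Rightarrow> real) \<Rightarrow> bool" where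
  "arc_length_parameter A G C I \<sigma> \<longleftrightarrow>
     (\<forall>t\<in>I. (\<sigma> has_real_derivative sqrt \<bar>G (C t) (velocity A C t) (velocity A C t)\<bar>) (at t))"

(* For a non-null curve this is meant to be applied to its arc length parameterization. *)
definition phi_slant_with ::
  "'m chart set \<Rightarrow> ('m \<Rightarrow> real^3 \<Rightarrow> real^3) \<Rightarrow> ('m \<Rightarrow> real^3) \<Rightarrow> ('m \<Rightarrow> real^3 \<Rightarrow> real) \<Rightarrow>
   ('m \<Rightarrow> real^3 \<Rightarrow> real^3 \<Rightarrow> real) \<Rightarrow> (real \<Rightarrow> 'm) \<Rightarrow> real set \<Rightarrow> real \<Rightarrow> real \<Rightarrow> bool" where
  "phi_slant_with A \<phi> \<xi> \<eta> G C I a b \<longleftrightarrow>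
     (\<forall>t\<in>I. G (C t) (velocity A C t) (\<xi> (C t)) = a \<and> \<eta> (C t) (velocity A C t) = a \<and>
            G (C t) (velocity A C t) (\<phi> (C t) (velocity A C t)) = b)"

definition phi_slant ::
  "'m chart set \<Rightarrow> ('m \<Rightarrow> real^3 \<Rightarrow> real^3) \<Rightarrow> ('m \<Rightarrow> real^3) \<Rightarrow> ('m \<Rightarrow> real^3 \<Rightarrow> real) \<Rightarrow>
   ('m \<Rightarrow> real^3 \<Rightarrow> real^3 \<Rightarrow> real) \<Rightarrow> (real \<Rightarrow> 'm) \<Rightarrow> real set \<Rightarrow> bool" where
  "phi_slant A \<phi> \<xi> \<eta> G C I \<longleftrightarrow> (\<exists>a b. phi_slant_with A \<phi> \<xi> \<eta> G C I a b)"

section \<open>The frame of a phi-slant null curve and its curvature\<close>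

definition frame_W1 ::
  "'m chart set \<Rightarrow> ('m \<Rightarrow> real^3 \<Rightarrow> real^3) \<Rightarrow> ('m \<Rightarrow> real^3) \<Rightarrow> (real \<Rightarrow> 'm) \<Rightarrow> real \<Rightarrow> real \<Rightarrow>
   real \<Rightarrow> real^3" where
  "frame_W1 A \<phi> \<xi> C a b t =
     - (b / sqrt (a^4 + b^2)) *\<^sub>R \<xi> (C t) + (a / sqrt (a^4 + b^2)) *\<^sub>R \<phi> (C t) (velocity A C t)"

definition frame_N1 ::
  "'m chart set \<Rightarrow> ('m \<Rightarrow> real^3 \<Rightarrow> real^3) \<Rightarrow> ('m \<Rightarrow> real^3) \<Rightarrow> (real \<Rightarrow> 'm) \<Rightarrow> real \<Rightarrow> real \<Rightarrow>
   real \<Rightarrow> real^3" where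
  "frame_N1 A \<phi> \<xi> C a b t =
     (a^3 / (a^4 + b^2)) *\<^sub>R \<xi> (C t) - (a^2 / (2 * (a^4 + b^2))) *\<^sub>R velocity A C t
     + (b / (a^4 + b^2)) *\<^sub>R \<phi> (C t) (velocity A C t)"

definition curvature_k1 ::
  "'m chart set \<Rightarrow> ('m \<Rightarrow> real^3 \<Rightarrow> real^3) \<Rightarrow> ('m \<Rightarrow> real^3) \<Rightarrow> 'm connection \<Rightarrow> (real \<Rightarrow> 'm) \<Rightarrow>
   real \<Rightarrow> real \<Rightarrow> real \<Rightarrow> real" where
  "curvature_k1 A \<phi> \<xi> nabla C a b t =
     (THE k. cov_deriv_along A nabla C (velocity A C) t = k *\<^sub>R frame_W1 A \<phi> \<xi> C a b t)"

section \<open>Frenet curves of osculating order 3\<close>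

definition frenet_apparatus ::
  "'m::topological_space chart set \<Rightarrow> ('m \<Rightarrow> real^3 \<Rightarrow> real^3 \<Rightarrow> real) \<Rightarrow> 'm connection \<Rightarrow>
   (real \<Rightarrow> 'm) \<Rightarrow> real set \<Rightarrow> real \<Rightarrow> real \<Rightarrow> real \<Rightarrow>
   (real \<Rightarrow> real^3) \<Rightarrow> (real \<Rightarrow> real^3) \<Rightarrow> (real \<Rightarrow> real^3) \<Rightarrow> (real \<Rightarrow> real) \<Rightarrow> (real \<Rightarrow> real) \<Rightarrow> bool" where
  "frenet_apparatus A G nabla \<gamma> J \<epsilon>1 \<epsilon>2 \<epsilon>3 E1 E2 E3 k \<tau> \<longleftrightarrow>
     smooth_curve A \<gamma> J \<and> unit_speed A G \<gamma> J \<epsilon>1 \<and>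
     \<epsilon>2 \<in> {1, -1} \<and> \<epsilon>3 \<in> {1, -1} \<and> \<epsilon>3 = - \<epsilon>1 * \<epsilon>2 \<and>
     vfield_along A \<gamma> J E1 \<and> vfield_along A \<gamma> J E2 \<and> vfield_along A \<gamma> J E3 \<and>
     (\<forall>s\<in>J.
        E1 s = velocity A \<gamma> s \<and>
        G (\<gamma> s) (E1 s) (E1 s) = \<epsilon>1 \<and> G (\<gamma> s) (E2 s) (E2 s) = \<epsilon>2 \<and> G (\<gamma> s) (E3 s) (E3 s) = \<epsilon>3 \<and>
        G (\<gamma> s) (E1 s) (E2 s) = 0 \<and> G (\<gamma> s) (E1 s) (E3 s) = 0 \<and> G (\<gamma> s) (E2 s) (E3 s) = 0 \<and>
        k s > 0 \<and> \<tau> s > 0 \<and>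
        cov_deriv_along A nabla \<gamma> E1 s = (\<epsilon>2 * k s) *\<^sub>R E2 s \<and>
        cov_deriv_along A nabla \<gamma> E2 s = - (\<epsilon>1 * k s) *\<^sub>R E1 s + (\<epsilon>3 * \<tau> s) *\<^sub>R E3 s \<and>
        cov_deriv_along A nabla \<gamma> E3 s = - (\<epsilon>2 * \<tau> s) *\<^sub>R E2 s)"

definition frenet_curve3 ::
  "'m::topological_space chart set \<Rightarrow> ('m \<Rightarrow> real^3 \<Rightarrow> real^3 \<Rightarrow> real) \<Rightarrow> 'm connection \<Rightarrow>
   (real \<Rightarrow> 'm) \<Rightarrow> real set \<Rightarrow> bool" where
  "frenet_curve3 A G nabla \<gamma> J \<longleftrightarrow>
     (\<exists>\<epsilon>1 \<epsilon>2 \<epsilon>3 E1 E2 E3 k \<tau>. frenet_apparatus A G nabla \<gamma> J \<epsilon>1 \<epsilon>2 \<epsilon>3 E1 E2 E3 k \<tau>)"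

end

theory Submission
  imports Defs
begin

text \<open>
  Pairing \<open>\<nabla>\<^sub>v v\<close>, for \<open>v\<close> the velocity of \<open>C\<close>, with the basis \<open>v, \<xi>, \<phi> v\<close> and differentiating the
  constants \<open>g(v, v) = 0\<close>, \<open>g(v, \<xi>) = a\<close>, \<open>g(v, \<phi> v) = 0\<close> gives \<open>\<nabla>\<^sub>v v = (\<theta>(\<xi>) a / 2) \<phi> v\<close>,
  that is, \<open>k\<^sub>1 = \<theta>(\<xi>) a\<^sup>2 / 2\<close>. The two Levi-Civita connections differ by the tensor
  \<open>\<theta>(\<xi>)/2 (g(x, \<phi> y) - g(\<phi> x, \<phi> y)) \<xi>\<close>, by Koszul's argument, so with respect to the associated
  metric the derivatives of \<open>v\<close>, \<open>\<xi>\<close> and \<open>\<phi> v\<close> along \<open>C\<close> are \<open>(\<theta>(\<xi>) a\<^sup>2 / 2) (\<phi> v / a - \<xi>)\<close>,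
  \<open>(\<theta>(\<xi>) / 2) \<phi> v\<close> and \<open>0\<close>. The associated metric has \<open>v\<close> of square \<open>a\<^sup>2\<close>, so arc length is an affine
  function of \<open>t\<close>, and the Frenet frame can be read off; it is unique because the curvatures are
  positive and the vectors have square \<open>\<plusminus>1\<close>.
\<close>

section \<open>Calculus of smooth maps\<close>

text \<open>Each tangent space is identified with \<open>real^3\<close> through a chart chosen at
  its own point, so raw components may jump from point to point. Smoothness is therefore tested on
  \<open>tcoord\<close> in a fixed chart, and objects known only near a point are compared on open
  sets. The sign of \<theta>(\<xi>) has to be one constant along the curve, although
  \<open>theta\<close> is a trace over a chart-dependent basis with no evident regularity. The F4
  identity at Y = \<xi> gives \<nabla>_x \<xi> = (\<theta>(\<xi>)/2) \<phi> x, which exhibits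
  \<theta>(\<xi>) locally as a quotient of differentiable functions. The arc length curve is again
  null and \<phi>-slant for g, now with slant constant \<open>sgn a\<close>. The formulas proved for
  C are thus instantiated a second time, where 1/a = a, and the frame found there is transported
  back. Torsion equals curvature because \<phi> v is parallel along the curve for the associated
  connection.\<close>

lemma Ck_on_subset: "Ck_on k S f \<Longrightarrow> T \<subseteq> S \<Longrightarrow> Ck_on k T f"
  by (induction k arbitrary: f) (auto intro: continuous_on_subset)

text \<open>\<open>frechet_derivative\<close> is a choice among the derivatives at the point.
  Locally equal functions have the same derivatives, so the choices agree even where no derivative
  exists.\<close>

lemma frechet_derivative_cong_open:
  assumes "open S" "x \<in> S" "\<And>x. x \<in> S \<Longrightarrow> f x = g x"
  shows "frechet_derivative f (at x) = frechet_derivative g (at x)"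
proof -
  have "(f has_derivative D) (at x) \<longleftrightarrow> (g has_derivative D) (at x)" for D
    using assms has_derivative_transform_within_open[of f D x UNIV S g]
      has_derivative_transform_within_open[of g D x UNIV S f] by auto
  then show ?thesis
    by (simp add: frechet_derivative_def)
qed

lemma differentiable_cong_open:
  assumes "open S" "x \<in> S" "\<And>x. x \<in> S \<Longrightarrow> f x = g x" "f differentiable (at x)"
  shows "g differentiable (at x)"
  using assms has_derivative_transform_within_open[of f _ x UNIV S g]
  unfolding differentiable_def by blast

lemma Ck_on_cong:
  assumes "open S" "\<And>x. x \<in> S \<Longrightarrow> f x = g x" "Ck_on k S f"
  shows "Ck_on k S g"
  using assms(2,3)
proof (induction k arbitrary: f g)
  case 0
  then show ?case by (metis Ck_on.simps(1) continuous_on_cong)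
next
  case (Suc k)
  have "g differentiable (at x)" if "x \<in> S" for x
    using differentiable_cong_open[OF assms(1) that, of f g] Suc.prems that by auto
  moreover have "Ck_on k S (\<lambda>x. frechet_derivative g (at x) v)" for v
  proof (rule Suc.IH)
    show "frechet_derivative f (at x) v = frechet_derivative g (at x) v" if "x \<in> S" for x
      using frechet_derivative_cong_open[OF assms(1) that, of f g] Suc.prems that by simp
  qed (use Suc.prems in simp)
  ultimately show ?case by simp
qed

text \<open>Allows an explicit formula in place of the chosen \<open>frechet_derivative\<close>; the
  sum, product and chain rules below are all proved in this form.\<close>

lemma Ck_on_SucI:
  assumes "open S" "\<And>x. x \<in> S \<Longrightarrow> (f has_derivative f' x) (at x)"
    and "\<And>v. Ck_on k S (\<lambda>x. f' x v)"
  shows "Ck_on (Suc k) S f"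
proof -
  have "Ck_on k S (\<lambda>x. frechet_derivative f (at x) v)" for v
  proof (rule Ck_on_cong[OF assms(1) _ assms(3)])
    show "f' x v = frechet_derivative f (at x) v" if "x \<in> S" for x
      using frechet_derivative_at[OF assms(2)[OF that]] by simp
  qed
  then show ?thesis
    using assms(2) by (auto simp: differentiable_def)
qed

lemma Ck_on_has_derivative:
  "Ck_on (Suc k) S f \<Longrightarrow> x \<in> S \<Longrightarrow> (f has_derivative frechet_derivative f (at x)) (at x)"
  using frechet_derivative_works by auto

lemma Ck_on_SucD: "Ck_on (Suc k) S f \<Longrightarrow> Ck_on k S f"
proof (induction k arbitrary: f)
  case 0
  then show ?case
    by (auto intro!: continuous_at_imp_continuous_on differentiable_imp_continuous_within)
next
  case (Suc k)
  then show ?case by (metis Ck_on.simps(2))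
qed

lemma Ck_on_const: "open S \<Longrightarrow> Ck_on k S (\<lambda>x. c)"
  by (induction k arbitrary: c) simp_all

lemma Ck_on_add:
  assumes "open S"
  shows "Ck_on k S f \<Longrightarrow> Ck_on k S g \<Longrightarrow> Ck_on k S (\<lambda>x. f x + g x)"
proof (induction k arbitrary: f g)
  case 0
  then show ?case by (auto intro: continuous_on_add)
next
  case (Suc k)
  show ?case
  proof (rule Ck_on_SucI[OF assms])
    show "((\<lambda>x. f x + g x) has_derivative
        (\<lambda>v. frechet_derivative f (at x) v + frechet_derivative g (at x) v)) (at x)"
      if "x \<in> S" for x
      using Suc.prems that by (intro has_derivative_add Ck_on_has_derivative)
  qed (use Suc in simp)
qed

text \<open>The Leibniz rule leaves products of one differentiated factor and one original factor;
  \<open>Ck_on_SucD\<close> lowers the order of the latter so that the induction hypothesis applies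
  to both.\<close>

lemma (in bounded_bilinear) Ck_on_prod:
  assumes "open S"
  shows "Ck_on k S f \<Longrightarrow> Ck_on k S g \<Longrightarrow> Ck_on k S (\<lambda>x. prod (f x) (g x))"
proof (induction k arbitrary: f g)
  case 0
  then show ?case by (auto intro: continuous_on)
next
  case (Suc k)
  show ?case
  proof (rule Ck_on_SucI[OF assms])
    show "((\<lambda>x. prod (f x) (g x)) has_derivative
        (\<lambda>v. prod (f x) (frechet_derivative g (at x) v) + prod (frechet_derivative f (at x) v) (g x)))
        (at x)" if "x \<in> S" for x
      using Suc.prems that by (intro FDERIV Ck_on_has_derivative)
    show "Ck_on k S (\<lambda>x. prod (f x) (frechet_derivative g (at x) v)
        + prod (frechet_derivative f (at x) v) (g x))" for v
      using Suc.prems Suc.prems[THEN Ck_on_SucD]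
      by (intro Ck_on_add assms Suc.IH) auto
  qed
qed

lemma (in bounded_linear) Ck_on_linear:
  assumes "open S"
  shows "Ck_on k S g \<Longrightarrow> Ck_on k S (\<lambda>x. f (g x))"
proof (induction k arbitrary: g)
  case 0
  then show ?case by (auto intro: continuous_on)
next
  case (Suc k)
  show ?case
  proof (rule Ck_on_SucI[OF assms])
    show "((\<lambda>x. f (g x)) has_derivative (\<lambda>v. f (frechet_derivative g (at x) v))) (at x)"
      if "x \<in> S" for x
      using Suc.prems that by (intro has_derivative Ck_on_has_derivative)
  qed (use Suc in simp)
qed

lemma Ck_on_sum:
  assumes "open S" "\<And>i. i \<in> B \<Longrightarrow> Ck_on k S (f i)"
  shows "Ck_on k S (\<lambda>x. \<Sum>i\<in>B. f i x)"
  using assms(2)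
  by (induction B rule: infinite_finite_induct)
     (auto intro: Ck_on_const Ck_on_add assms(1))

text \<open>In the chain rule both the base point and the direction of the derivative of
  \<open>f\<close> vary with \<open>x\<close>, whereas \<open>Ck_on\<close> controls derivatives in
  fixed directions only. Expanding the direction over \<open>Basis\<close> separates the two
  dependences, which is why the intermediate space is Euclidean.\<close>

lemma Ck_on_compose:
  fixes f :: "'b::euclidean_space \<Rightarrow> 'c::real_normed_vector"
  assumes "open S" "g ` S \<subseteq> T"
  shows "Ck_on k T f \<Longrightarrow> Ck_on k S g \<Longrightarrow> Ck_on k S (\<lambda>x. f (g x))"
proof (induction k arbitrary: f)
  case 0
  then show ?case
    using assms by (auto intro: continuous_on_compose2)
next
  case (Suc k)
  have T: "g x \<in> T" if "x \<in> S" for x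
    using assms(2) that by blast
  show ?case
  proof (rule Ck_on_SucI[OF assms(1)])
    fix x assume x: "x \<in> S"
    note f' = Ck_on_has_derivative[OF Suc.prems(1) T[OF x]]
    have "(\<Sum>i\<in>Basis. (frechet_derivative g (at x) v \<bullet> i) *\<^sub>R frechet_derivative f (at (g x)) i)
        = frechet_derivative f (at (g x)) (frechet_derivative g (at x) v)" for v
      using has_derivative_linear[OF f']
      by (subst (4) euclidean_representation[symmetric]) (simp add: linear_sum linear_scale)
    moreover have "((\<lambda>x. f (g x)) has_derivative
        (\<lambda>v. frechet_derivative f (at (g x)) (frechet_derivative g (at x) v))) (at x)"
      by (rule has_derivative_compose[OF Ck_on_has_derivative[OF Suc.prems(2) x] f'])
    ultimately show "((\<lambda>x. f (g x)) has_derivative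
        (\<lambda>v. \<Sum>i\<in>Basis. (frechet_derivative g (at x) v \<bullet> i) *\<^sub>R
          frechet_derivative f (at (g x)) i)) (at x)"
      by simp
  next
    fix v
    have "Ck_on k S (\<lambda>x. frechet_derivative f (at (g x)) i)" for i
      using Suc.prems(1) Ck_on_SucD[OF Suc.prems(2)] by (intro Suc.IH) auto
    moreover have "Ck_on k S (\<lambda>x. frechet_derivative g (at x) v \<bullet> i)" for i
      using Suc.prems(2) by (intro bounded_linear.Ck_on_linear[OF bounded_linear_inner_left] assms) auto
    ultimately show "Ck_on k S (\<lambda>x. \<Sum>i\<in>Basis. (frechet_derivative g (at x) v \<bullet> i) *\<^sub>R
          frechet_derivative f (at (g x)) i)"
      by (intro Ck_on_sum bounded_bilinear.Ck_on_prod[OF bounded_bilinear_scaleR] assms)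
  qed
qed

lemma smooth_on_subset: "smooth_on S f \<Longrightarrow> T \<subseteq> S \<Longrightarrow> smooth_on T f"
  by (auto simp: smooth_on_def intro: Ck_on_subset)

lemma smooth_on_cong:
  "smooth_on S f \<Longrightarrow> open S \<Longrightarrow> (\<And>x. x \<in> S \<Longrightarrow> f x = g x) \<Longrightarrow> smooth_on S g"
  unfolding smooth_on_def by (blast intro: Ck_on_cong)

lemma smooth_on_const: "open S \<Longrightarrow> smooth_on S (\<lambda>x. c)"
  by (simp add: smooth_on_def Ck_on_const)

lemma smooth_on_add:
  "open S \<Longrightarrow> smooth_on S f \<Longrightarrow> smooth_on S g \<Longrightarrow> smooth_on S (\<lambda>x. f x + g x)"
  by (simp add: smooth_on_def Ck_on_add)

lemma smooth_on_sum:
  "open S \<Longrightarrow> (\<And>i. i \<in> B \<Longrightarrow> smooth_on S (f i)) \<Longrightarrow> smooth_on S (\<lambda>x. \<Sum>i\<in>B. f i x)"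
  by (simp add: smooth_on_def Ck_on_sum)

lemma smooth_on_scaleR:
  "open S \<Longrightarrow> smooth_on S f \<Longrightarrow> smooth_on S g \<Longrightarrow> smooth_on S (\<lambda>x. f x *\<^sub>R g x)"
  by (simp add: smooth_on_def bounded_bilinear.Ck_on_prod[OF bounded_bilinear_scaleR])

lemma smooth_on_bounded_linear:
  "bounded_linear h \<Longrightarrow> open S \<Longrightarrow> smooth_on S f \<Longrightarrow> smooth_on S (\<lambda>x. h (f x))"
  by (simp add: smooth_on_def bounded_linear.Ck_on_linear)

lemma smooth_on_compose:
  fixes f :: "'b::euclidean_space \<Rightarrow> 'c::real_normed_vector"
  assumes "smooth_on T f" "smooth_on S g" "open S" "g ` S \<subseteq> T"
  shows "smooth_on S (\<lambda>x. f (g x))"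
  using assms(1,2) Ck_on_compose[OF assms(3,4)] unfolding smooth_on_def by blast

lemma smooth_on_frechet_derivative:
  assumes "smooth_on S f"
  shows "smooth_on S (\<lambda>x. frechet_derivative f (at x) v)"
  unfolding smooth_on_def
proof
  fix k
  have "Ck_on (Suc k) S f"
    using assms unfolding smooth_on_def by blast
  then show "Ck_on k S (\<lambda>x. frechet_derivative f (at x) v)"
    by simp
qed

lemma smooth_on_differentiable:
  assumes "smooth_on S f" "x \<in> S"
  shows "f differentiable (at x)"
proof -
  have "Ck_on (Suc 0) S f"
    using assms(1) unfolding smooth_on_def by blast
  then show ?thesis using assms(2) by simp
qed

lemma smooth_on_ident:
  fixes S :: "real set"
  assumes "open S"
  shows "smooth_on S (\<lambda>x. x)"
  unfolding smooth_on_def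
proof
  fix k show "Ck_on k S (\<lambda>x. x)"
    by (cases k) (auto intro!: Ck_on_SucI[OF assms has_derivative_ident] Ck_on_const assms)
qed

section \<open>Charts and vector fields\<close>

locale smooth_manifold3 =
  fixes A :: "'m::{t2_space,second_countable_topology} chart set"
  assumes atlas: "smooth_atlas A"
begin

lemma chart_at_atlas [simp]: "chart_at A p \<in> A" and chart_at_mem [simp]: "p \<in> fst (chart_at A p)"
proof -
  have "p \<in> (\<Union>c\<in>A. fst c)"
    using atlas by (simp add: smooth_atlas_def)
  then have "\<exists>c. c \<in> A \<and> p \<in> fst c" by blast
  from someI_ex[OF this] show "chart_at A p \<in> A" "p \<in> fst (chart_at A p)"
    by (simp_all add: chart_at_def)
qed

lemma chart_homeomorphism:
  "c \<in> A \<Longrightarrow> homeomorphism (fst c) (snd c ` fst c) (snd c) (chart_inv c)"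
  using atlas by (simp add: smooth_atlas_def is_chart_def)

lemma open_chart [simp]: "c \<in> A \<Longrightarrow> open (fst c)"
  using atlas by (simp add: smooth_atlas_def is_chart_def)

lemma open_chart_image:
  assumes "c \<in> A" "open V" "V \<subseteq> fst c"
  shows "open (snd c ` V)"
proof -
  have "openin (top_of_set (snd c ` fst c)) (snd c ` V)"
    using assms by (intro homeomorphism_imp_open_map[OF chart_homeomorphism])
      (auto simp: openin_open)
  moreover have "open (snd c ` fst c)"
    using atlas assms by (simp add: smooth_atlas_def is_chart_def)
  ultimately show ?thesis
    using openin_open_trans by blast
qed

lemma chart_inv_chart [simp]: "c \<in> A \<Longrightarrow> p \<in> fst c \<Longrightarrow> chart_inv c (snd c p) = p"
  using chart_homeomorphism by (auto simp: homeomorphism_def)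

lemma transition_smooth:
  "c \<in> A \<Longrightarrow> d \<in> A \<Longrightarrow> smooth_on (snd c ` (fst c \<inter> fst d)) (snd d \<circ> chart_inv c)"
  using atlas by (simp add: smooth_atlas_def)

section \<open>Transition maps and the components of tangent vectors\<close>

lemma transition_has_derivative:
  assumes "c \<in> A" "d \<in> A" "p \<in> fst c" "p \<in> fst d"
  shows "((snd d \<circ> chart_inv c) has_derivative
    frechet_derivative (snd d \<circ> chart_inv c) (at (snd c p))) (at (snd c p))"
  using smooth_on_differentiable[OF transition_smooth[OF assms(1,2)], of "snd c p"] assms
  by (auto simp: frechet_derivative_works[symmetric])

text \<open>Chain rule for the composite of two transition maps, which agrees with the direct one on
  the image of the triple overlap. With equal outer charts it makes \<open>tcoord\<close> and
  \<open>tvec\<close> mutually inverse.\<close>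

lemma transition_cocycle:
  assumes "c \<in> A" "d \<in> A" "e \<in> A" "p \<in> fst c" "p \<in> fst d" "p \<in> fst e"
  shows "frechet_derivative (snd e \<circ> chart_inv d) (at (snd d p))
      (frechet_derivative (snd d \<circ> chart_inv c) (at (snd c p)) y) =
    frechet_derivative (snd e \<circ> chart_inv c) (at (snd c p)) y"
proof -
  let ?V = "fst c \<inter> fst d \<inter> fst e"
  have d: "(snd d \<circ> chart_inv c) (snd c p) = snd d p"
    using assms by simp
  have comp: "((\<lambda>x. (snd e \<circ> chart_inv d) ((snd d \<circ> chart_inv c) x)) has_derivative
      (\<lambda>y. frechet_derivative (snd e \<circ> chart_inv d) (at (snd d p))
        (frechet_derivative (snd d \<circ> chart_inv c) (at (snd c p)) y))) (at (snd c p))"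
    by (rule has_derivative_compose[OF transition_has_derivative])
       (use transition_has_derivative[of d e p] assms in \<open>simp_all add: comp_def\<close>)
  have "((snd e \<circ> chart_inv c) has_derivative
      (\<lambda>y. frechet_derivative (snd e \<circ> chart_inv d) (at (snd d p))
        (frechet_derivative (snd d \<circ> chart_inv c) (at (snd c p)) y))) (at (snd c p))"
    by (rule has_derivative_transform_within_open[OF comp, of "snd c ` ?V"])
       (use assms in \<open>auto intro!: open_chart_image open_Int\<close>)
  from frechet_derivative_at[OF this] show ?thesis by metis
qed

lemma transition_self:
  assumes "c \<in> A" "p \<in> fst c"
  shows "frechet_derivative (snd c \<circ> chart_inv c) (at (snd c p)) y = y"
proof -
  have "frechet_derivative (snd c \<circ> chart_inv c) (at (snd c p))
      = frechet_derivative (\<lambda>x. x) (at (snd c p))"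
    by (rule frechet_derivative_cong_open[of "snd c ` fst c"])
       (use assms open_chart_image[of c "fst c"] in auto)
  then show ?thesis by (simp add: frechet_derivative_ident)
qed

lemma linear_tcoord: "c \<in> A \<Longrightarrow> p \<in> fst c \<Longrightarrow> linear (tcoord A c p)"
  unfolding tcoord_def by (rule has_derivative_linear[OF transition_has_derivative]) auto

lemma linear_tvec: "c \<in> A \<Longrightarrow> p \<in> fst c \<Longrightarrow> linear (tvec A c p)"
  unfolding tvec_def by (rule has_derivative_linear[OF transition_has_derivative]) auto

lemma tcoord_tvec [simp]: "c \<in> A \<Longrightarrow> p \<in> fst c \<Longrightarrow> tcoord A c p (tvec A c p y) = y"
  unfolding tcoord_def tvec_def by (simp add: transition_cocycle transition_self)

lemma tvec_tcoord [simp]: "c \<in> A \<Longrightarrow> p \<in> fst c \<Longrightarrow> tvec A c p (tcoord A c p x) = x"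
  unfolding tcoord_def tvec_def by (simp add: transition_cocycle transition_self)

lemma tvec_chart_at [simp]: "tvec A (chart_at A p) p y = y"
  unfolding tvec_def by (simp add: transition_self)

lemma tcoord_chart_at [simp]: "tcoord A (chart_at A p) p y = y"
  unfolding tcoord_def by (simp add: transition_self)

lemma tcoord_change:
  assumes "c \<in> A" "d \<in> A" "p \<in> fst c" "p \<in> fst d"
  shows "tcoord A d p x = frechet_derivative (snd d \<circ> chart_inv c) (at (snd c p)) (tcoord A c p x)"
  unfolding tcoord_def using assms by (simp add: transition_cocycle)

lemma tvec_sum:
  assumes "c \<in> A" "p \<in> fst c"
  shows "tvec A c p y = (\<Sum>i\<in>UNIV. (y $ i) *\<^sub>R coord_frame A c i p)"
proof -
  have "y = (\<Sum>i\<in>UNIV. (y $ i) *\<^sub>R axis i 1)"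
    using basis_expansion[of y] by (simp add: scalar_mult_eq_scaleR)
  then have "tvec A c p y = tvec A c p (\<Sum>i\<in>UNIV. (y $ i) *\<^sub>R axis i 1)"
    by simp
  also have "\<dots> = (\<Sum>i\<in>UNIV. (y $ i) *\<^sub>R coord_frame A c i p)"
    by (simp add: linear_sum[OF linear_tvec[OF assms]] linear_scale[OF linear_tvec[OF assms]] coord_frame_def)
  finally show ?thesis .
qed

lemma coord_frame_expansion:
  "c \<in> A \<Longrightarrow> p \<in> fst c \<Longrightarrow> (\<Sum>i\<in>UNIV. (tcoord A c p x $ i) *\<^sub>R coord_frame A c i p) = x"
  using tvec_sum[of c p "tcoord A c p x"] by simp

section \<open>Smoothness checked in a single chart\<close>

lemma smooth_on_change_chart:
  fixes f :: "'m \<Rightarrow> 'b::real_normed_vector"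
  assumes "c \<in> A" "d \<in> A" "open V" "V \<subseteq> fst c" "smooth_on (snd c ` V) (f \<circ> chart_inv c)"
  shows "smooth_on (snd d ` (V \<inter> fst d)) (f \<circ> chart_inv d)"
proof -
  let ?S = "snd d ` (V \<inter> fst d)"
  have S: "open ?S"
    using assms by (intro open_chart_image) auto
  have "smooth_on ?S (\<lambda>x. (f \<circ> chart_inv c) ((snd c \<circ> chart_inv d) x))"
    by (rule smooth_on_compose[OF assms(5) smooth_on_subset[OF transition_smooth[of d c]] S])
       (use assms in auto)
  then show ?thesis
    by (rule smooth_on_cong[OF _ S]) (use assms in auto)
qed

lemma smooth_fun_on_chart:
  "c \<in> A \<Longrightarrow> open V \<Longrightarrow> V \<subseteq> fst c \<Longrightarrow> smooth_on (snd c ` V) (f \<circ> chart_inv c) \<Longrightarrow> smooth_fun_on A V f"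
  unfolding smooth_fun_on_def by (blast intro: smooth_on_change_chart)

text \<open>The components in another chart \<open>d\<close> are the Jacobian of the transition map
  applied to those in \<open>c\<close>. The columns \<open>T i\<close> of the Jacobian are smooth,
  being derivatives of a smooth map in fixed directions.\<close>

lemma vfield_on_chart:
  assumes "c \<in> A" "open V" "V \<subseteq> fst c"
    and "smooth_on (snd c ` V) ((\<lambda>q. tcoord A c q (X q)) \<circ> chart_inv c)"
  shows "vfield_on A V X"
  unfolding vfield_on_def
proof
  fix d assume d: "d \<in> A"
  let ?S = "snd d ` (V \<inter> fst d)"
  have S: "open ?S"
    using assms d by (intro open_chart_image) auto
  define T where "T i x = frechet_derivative (snd d \<circ> chart_inv c) (at x) (axis i 1)" for i :: 3 and x
  have "smooth_on (snd c ` (fst c \<inter> fst d)) (T i)" for i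
    unfolding T_def using assms d by (intro smooth_on_frechet_derivative transition_smooth)
  then have 1: "smooth_on ?S (\<lambda>x. T i ((snd c \<circ> chart_inv d) x))" for i
    by (rule smooth_on_compose[OF _ smooth_on_subset[OF transition_smooth[of d c]] S])
       (use assms d in auto)
  have 2: "smooth_on ?S (\<lambda>x. ((\<lambda>q. tcoord A c q (X q)) \<circ> chart_inv d) x $ i)" for i
    by (intro smooth_on_bounded_linear[OF bounded_linear_vec_nth S] smooth_on_change_chart[OF assms(1) d] assms)
  have "smooth_on ?S (\<lambda>x. \<Sum>i\<in>UNIV. (((\<lambda>q. tcoord A c q (X q)) \<circ> chart_inv d) x $ i) *\<^sub>R
      T i ((snd c \<circ> chart_inv d) x))"
    by (intro smooth_on_sum smooth_on_scaleR S 1 2)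
  then show "smooth_on ?S ((\<lambda>q. tcoord A d q (X q)) \<circ> chart_inv d)"
  proof (rule smooth_on_cong[OF _ S])
    fix x assume "x \<in> ?S"
    then obtain q where q: "x = snd d q" "q \<in> V" "q \<in> fst d" by auto
    define y where "y = tcoord A c q (X q)"
    define L where "L = frechet_derivative (snd d \<circ> chart_inv c) (at (snd c q))"
    have L: "linear L"
      unfolding L_def
      by (rule has_derivative_linear[OF transition_has_derivative]) (use q assms d in auto)
    have "(\<Sum>i\<in>UNIV. (y $ i) *\<^sub>R L (axis i 1)) = L (\<Sum>i\<in>UNIV. (y $ i) *\<^sub>R axis i 1)"
      by (simp add: linear_sum[OF L] linear_scale[OF L])
    also have "\<dots> = L y"
      using basis_expansion[of y] by (simp add: scalar_mult_eq_scaleR)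
    also have "\<dots> = tcoord A d q (X q)"
      unfolding L_def y_def by (rule tcoord_change[symmetric]) (use q assms d in auto)
    finally show "(\<Sum>i\<in>UNIV. (((\<lambda>q. tcoord A c q (X q)) \<circ> chart_inv d) x $ i) *\<^sub>R
      T i ((snd c \<circ> chart_inv d) x)) = ((\<lambda>q. tcoord A d q (X q)) \<circ> chart_inv d) x"
      using q d assms by (simp add: T_def y_def L_def)
  qed
qed

lemma vfield_on_subset: "vfield_on A U X \<Longrightarrow> V \<subseteq> U \<Longrightarrow> vfield_on A V X"
  unfolding vfield_on_def by (meson Int_mono image_mono order_refl smooth_on_subset)

text \<open>Shrinks the neighbourhood into the chart chosen at \<open>p\<close>, where the
  smoothness of several fields can be combined by working with one set of components.\<close>

lemma vfield_nearE:
  assumes "vfield_near A p X"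
  obtains V where "open V" "p \<in> V" "V \<subseteq> fst (chart_at A p)" "vfield_on A V X"
    "smooth_on (snd (chart_at A p) ` V)
      ((\<lambda>q. tcoord A (chart_at A p) q (X q)) \<circ> chart_inv (chart_at A p))"
proof -
  obtain U where U: "open U" "p \<in> U" "vfield_on A U X"
    using assms by (auto simp: vfield_near_def)
  let ?V = "U \<inter> fst (chart_at A p)"
  have "smooth_on (snd (chart_at A p) ` ?V)
      ((\<lambda>q. tcoord A (chart_at A p) q (X q)) \<circ> chart_inv (chart_at A p))"
    using U(3) by (simp add: vfield_on_def)
  moreover have "vfield_on A ?V X"
    using vfield_on_subset[OF U(3)] by simp
  ultimately show ?thesis
    using that[of ?V] U by (auto simp: open_Int)
qed

lemma vfield_near_add:
  assumes "vfield_near A p X" "vfield_near A p Y"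
  shows "vfield_near A p (\<lambda>q. X q + Y q)"
proof -
  let ?c = "chart_at A p"
  obtain U where U: "open U" "p \<in> U" "U \<subseteq> fst ?c"
    "smooth_on (snd ?c ` U) ((\<lambda>q. tcoord A ?c q (X q)) \<circ> chart_inv ?c)"
    using vfield_nearE[OF assms(1)] by metis
  obtain V where V: "open V" "p \<in> V" "V \<subseteq> fst ?c"
    "smooth_on (snd ?c ` V) ((\<lambda>q. tcoord A ?c q (Y q)) \<circ> chart_inv ?c)"
    using vfield_nearE[OF assms(2)] by metis
  have S: "open (snd ?c ` (U \<inter> V))"
    using U V by (intro open_chart_image) auto
  have "smooth_on (snd ?c ` (U \<inter> V)) (\<lambda>x. ((\<lambda>q. tcoord A ?c q (X q)) \<circ> chart_inv ?c) x
      + ((\<lambda>q. tcoord A ?c q (Y q)) \<circ> chart_inv ?c) x)"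
    by (intro smooth_on_add S smooth_on_subset[OF U(4)] smooth_on_subset[OF V(4)]) auto
  then have "smooth_on (snd ?c ` (U \<inter> V)) ((\<lambda>q. tcoord A ?c q (X q + Y q)) \<circ> chart_inv ?c)"
    by (rule smooth_on_cong[OF _ S]) (use U(3) in \<open>auto simp: linear_add[OF linear_tcoord]\<close>)
  then have "vfield_on A (U \<inter> V) (\<lambda>q. X q + Y q)"
    using U V by (intro vfield_on_chart[of ?c]) auto
  then show ?thesis
    using U V by (auto simp: vfield_near_def intro!: exI[of _ "U \<inter> V"])
qed

lemma vfield_near_scaleR:
  assumes "smooth_fun_near A p f" "vfield_near A p Y"
  shows "vfield_near A p (\<lambda>q. f q *\<^sub>R Y q)"
proof -
  let ?c = "chart_at A p"
  obtain U where U: "open U" "p \<in> U" "smooth_fun_on A U f"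
    using assms(1) by (auto simp: smooth_fun_near_def)
  obtain V where V: "open V" "p \<in> V" "V \<subseteq> fst ?c"
    "smooth_on (snd ?c ` V) ((\<lambda>q. tcoord A ?c q (Y q)) \<circ> chart_inv ?c)"
    using vfield_nearE[OF assms(2)] by metis
  have S: "open (snd ?c ` (U \<inter> V))"
    using U V by (intro open_chart_image) auto
  have f: "smooth_on (snd ?c ` (U \<inter> fst ?c)) (f \<circ> chart_inv ?c)"
    using U(3) by (simp add: smooth_fun_on_def)
  have "smooth_on (snd ?c ` (U \<inter> V)) (\<lambda>x. (f \<circ> chart_inv ?c) x
      *\<^sub>R ((\<lambda>q. tcoord A ?c q (Y q)) \<circ> chart_inv ?c) x)"
    using V by (intro smooth_on_scaleR S smooth_on_subset[OF f] smooth_on_subset[OF V(4)]) auto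
  then have "smooth_on (snd ?c ` (U \<inter> V)) ((\<lambda>q. tcoord A ?c q (f q *\<^sub>R Y q)) \<circ> chart_inv ?c)"
    by (rule smooth_on_cong[OF _ S]) (use V(3) in \<open>auto simp: linear_scale[OF linear_tcoord]\<close>)
  then have "vfield_on A (U \<inter> V) (\<lambda>q. f q *\<^sub>R Y q)"
    using U V by (intro vfield_on_chart[of ?c]) auto
  then show ?thesis
    using U V by (auto simp: vfield_near_def intro!: exI[of _ "U \<inter> V"])
qed

lemma smooth_fun_near_const: "smooth_fun_near A p (\<lambda>q. c)"
  unfolding smooth_fun_near_def smooth_fun_on_def
  by (rule exI[of _ UNIV])
     (auto simp: comp_def intro!: smooth_on_const open_chart_image open_chart)

text \<open>Extends a tangent vector \<open>y\<close> at \<open>p\<close> to the field with constant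
  components in the chart chosen at \<open>p\<close>. Connections act on fields, so this is how
  tensorial identities are evaluated on single vectors; only the values on that chart domain carry
  meaning.\<close>

definition const_field :: "'m \<Rightarrow> real^3 \<Rightarrow> 'm \<Rightarrow> real^3" where
  "const_field p y q = tvec A (chart_at A p) q y"

lemma const_field_at [simp]: "const_field p y p = y"
  by (simp add: const_field_def)

lemma const_field_axis: "const_field p (axis i 1) = coord_frame A (chart_at A p) i"
  by (simp add: const_field_def coord_frame_def fun_eq_iff)

lemma vfield_on_const_field: "vfield_on A (fst (chart_at A p)) (const_field p y)"
proof (rule vfield_on_chart[of "chart_at A p"])
  let ?c = "chart_at A p"
  have S: "open (snd ?c ` fst ?c)"
    by (intro open_chart_image open_chart) auto
  show "smooth_on (snd ?c ` fst ?c) ((\<lambda>q. tcoord A ?c q (const_field p y q)) \<circ> chart_inv ?c)"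
    by (rule smooth_on_cong[OF smooth_on_const[OF S, of y] S]) (auto simp: const_field_def)
qed (auto intro: open_chart)

lemma vfield_near_const_field: "vfield_near A p (const_field p y)"
  using vfield_on_const_field open_chart unfolding vfield_near_def
  by (metis chart_at_atlas chart_at_mem)

lemma vfield_near_coord_frame: "vfield_near A p (coord_frame A (chart_at A p) i)"
  using vfield_near_const_field const_field_axis by metis

lemma smooth_fun_near_tcoord:
  assumes "vfield_near A p X"
  shows "smooth_fun_near A p (\<lambda>q. tcoord A (chart_at A p) q (X q) $ i)"
proof -
  let ?c = "chart_at A p"
  obtain V where V: "open V" "p \<in> V" "V \<subseteq> fst ?c"
    "smooth_on (snd ?c ` V) ((\<lambda>q. tcoord A ?c q (X q)) \<circ> chart_inv ?c)"
    using vfield_nearE[OF assms] by metis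
  have S: "open (snd ?c ` V)"
    using V by (intro open_chart_image) auto
  have "smooth_on (snd ?c ` V) (\<lambda>x. ((\<lambda>q. tcoord A ?c q (X q)) \<circ> chart_inv ?c) x $ i)"
    by (intro smooth_on_bounded_linear[OF bounded_linear_vec_nth S] V)
  then have "smooth_fun_on A V (\<lambda>q. tcoord A ?c q (X q) $ i)"
    using V by (intro smooth_fun_on_chart[of ?c]) (auto simp: comp_def)
  then show ?thesis
    using V by (auto simp: smooth_fun_near_def)
qed

lemma vfield_near_cong:
  assumes "vfield_near A p X" "open U" "p \<in> U" "\<And>q. q \<in> U \<Longrightarrow> X q = Y q"
  shows "vfield_near A p Y"
proof -
  let ?c = "chart_at A p"
  obtain V where V: "open V" "p \<in> V" "V \<subseteq> fst ?c"
    "smooth_on (snd ?c ` V) ((\<lambda>q. tcoord A ?c q (X q)) \<circ> chart_inv ?c)"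
    using vfield_nearE[OF assms(1)] by metis
  have S: "open (snd ?c ` (U \<inter> V))"
    using assms V by (intro open_chart_image) auto
  have "smooth_on (snd ?c ` (U \<inter> V)) ((\<lambda>q. tcoord A ?c q (Y q)) \<circ> chart_inv ?c)"
    by (rule smooth_on_cong[OF smooth_on_subset[OF V(4)] S]) (use V(3) assms(4) in auto)
  then have "vfield_on A (U \<inter> V) Y"
    using V assms by (intro vfield_on_chart[of ?c]) auto
  then show ?thesis
    using assms V by (auto simp: vfield_near_def intro!: exI[of _ "U \<inter> V"])
qed

lemma vfield_near_sum:
  assumes "\<And>j. j \<in> B \<Longrightarrow> vfield_near A p (X j)"
  shows "vfield_near A p (\<lambda>q. \<Sum>j\<in>B. X j q)"
proof -
  have "vfield_near A p (\<lambda>q. 0)"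
    using vfield_near_scaleR[OF smooth_fun_near_const[of p 0] vfield_near_const_field[of p 0]] by simp
  with assms show ?thesis
    by (induction B rule: infinite_finite_induct) (auto intro: vfield_near_add)
qed

section \<open>Directional derivatives\<close>

text \<open>\<open>dir_deriv\<close> is a chosen derivative, meaningful only where one exists. This
  predicate records existence in the very chart in which \<open>dir_deriv\<close> is
  computed.\<close>

definition differentiable_fun_at :: "'m \<Rightarrow> ('m \<Rightarrow> real) \<Rightarrow> bool" where
  "differentiable_fun_at p f \<longleftrightarrow>
    (f \<circ> chart_inv (chart_at A p)) differentiable (at (snd (chart_at A p) p))"

lemma differentiable_fun_at_has_derivative:
  "differentiable_fun_at p f \<Longrightarrow>
    ((f \<circ> chart_inv (chart_at A p)) has_derivative (\<lambda>v. dir_deriv A p v f)) (at (snd (chart_at A p) p))"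
  unfolding differentiable_fun_at_def dir_deriv_def by (simp add: frechet_derivative_works)

lemma dir_derivI:
  assumes "((f \<circ> chart_inv (chart_at A p)) has_derivative D) (at (snd (chart_at A p) p))"
  shows "differentiable_fun_at p f" "dir_deriv A p v f = D v"
  using assms frechet_derivative_at[OF assms]
  by (auto simp: differentiable_fun_at_def dir_deriv_def differentiable_def)

lemma differentiable_fun_at_add:
  assumes "differentiable_fun_at p f" "differentiable_fun_at p h"
  shows "differentiable_fun_at p (\<lambda>q. f q + h q)"
    "dir_deriv A p v (\<lambda>q. f q + h q) = dir_deriv A p v f + dir_deriv A p v h"
proof -
  have "((\<lambda>x. (f \<circ> chart_inv (chart_at A p)) x + (h \<circ> chart_inv (chart_at A p)) x) has_derivative
      (\<lambda>v. dir_deriv A p v f + dir_deriv A p v h)) (at (snd (chart_at A p) p))"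
    by (intro has_derivative_add differentiable_fun_at_has_derivative assms)
  then have *: "(((\<lambda>q. f q + h q) \<circ> chart_inv (chart_at A p)) has_derivative
      (\<lambda>v. dir_deriv A p v f + dir_deriv A p v h)) (at (snd (chart_at A p) p))"
    by (simp add: comp_def)
  show "differentiable_fun_at p (\<lambda>q. f q + h q)"
    "dir_deriv A p v (\<lambda>q. f q + h q) = dir_deriv A p v f + dir_deriv A p v h"
    by (rule dir_derivI[OF *])+
qed

lemma differentiable_fun_at_mult:
  assumes "differentiable_fun_at p f" "differentiable_fun_at p h"
  shows "differentiable_fun_at p (\<lambda>q. f q * h q)"
    "dir_deriv A p v (\<lambda>q. f q * h q) = dir_deriv A p v f * h p + f p * dir_deriv A p v h"
proof -
  have "((\<lambda>x. (f \<circ> chart_inv (chart_at A p)) x * (h \<circ> chart_inv (chart_at A p)) x) has_derivative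
      (\<lambda>v. f p * dir_deriv A p v h + dir_deriv A p v f * h p)) (at (snd (chart_at A p) p))"
    using has_derivative_mult[OF differentiable_fun_at_has_derivative[OF assms(1)]
        differentiable_fun_at_has_derivative[OF assms(2)]] by simp
  then have *: "(((\<lambda>q. f q * h q) \<circ> chart_inv (chart_at A p)) has_derivative
      (\<lambda>v. f p * dir_deriv A p v h + dir_deriv A p v f * h p)) (at (snd (chart_at A p) p))"
    by (simp add: comp_def)
  show "differentiable_fun_at p (\<lambda>q. f q * h q)"
    by (rule dir_derivI(1)[OF *])
  show "dir_deriv A p v (\<lambda>q. f q * h q) = dir_deriv A p v f * h p + f p * dir_deriv A p v h"
    using dir_derivI(2)[OF *] by simp
qed

lemma dir_deriv_cong:
  assumes "open U" "p \<in> U" "\<And>q. q \<in> U \<Longrightarrow> f q = h q"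
  shows "dir_deriv A p v f = dir_deriv A p v h"
    "differentiable_fun_at p f \<Longrightarrow> differentiable_fun_at p h"
proof -
  let ?c = "chart_at A p"
  have S: "open (snd ?c ` (U \<inter> fst ?c))" "snd ?c p \<in> snd ?c ` (U \<inter> fst ?c)"
    using assms by (auto intro!: open_chart_image open_Int)
  have eq: "(f \<circ> chart_inv ?c) x = (h \<circ> chart_inv ?c) x" if "x \<in> snd ?c ` (U \<inter> fst ?c)" for x
    using that assms(3) by auto
  show "dir_deriv A p v f = dir_deriv A p v h"
    unfolding dir_deriv_def by (rule fun_cong[OF frechet_derivative_cong_open[OF S eq]])
  show "differentiable_fun_at p h" if "differentiable_fun_at p f"
    by (use that in \<open>simp add: differentiable_fun_at_def\<close>)
       (rule differentiable_cong_open[OF S, where f = "f \<circ> chart_inv ?c"], use eq in auto)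
qed

lemma dir_deriv_const [simp]: "dir_deriv A p v (\<lambda>q. c) = 0"
  by (simp add: dir_deriv_def comp_def)

lemma smooth_fun_near_imp_differentiable:
  assumes "smooth_fun_near A p f"
  shows "differentiable_fun_at p f"
proof -
  obtain U where U: "open U" "p \<in> U" "smooth_fun_on A U f"
    using assms by (auto simp: smooth_fun_near_def)
  then have "smooth_on (snd (chart_at A p) ` (U \<inter> fst (chart_at A p))) (f \<circ> chart_inv (chart_at A p))"
    by (simp add: smooth_fun_on_def)
  from smooth_on_differentiable[OF this] show ?thesis
    using U by (auto simp: differentiable_fun_at_def)
qed

lemma differentiable_fun_at_sum:
  "(\<And>j. j \<in> B \<Longrightarrow> differentiable_fun_at p (f j)) \<Longrightarrow> differentiable_fun_at p (\<lambda>q. \<Sum>j\<in>B. f j q)"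
proof (induction B rule: infinite_finite_induct)
  case (insert x F)
  then show ?case by (simp add: differentiable_fun_at_add(1))
qed (simp_all add: differentiable_fun_at_def comp_def)

text \<open>\<open>is_lie_bracket\<close> fixes the action of a vector on smooth functions. Testing
  on the coordinate functions of the chart at \<open>p\<close> returns its components.\<close>

lemma lie_bracket_unique:
  assumes "is_lie_bracket A X Y p w" "is_lie_bracket A X Y p w'"
  shows "w = w'"
proof -
  let ?c = "chart_at A p"
  have "w $ i = w' $ i" for i
  proof -
    let ?f = "\<lambda>q. snd ?c q $ i"
    have "smooth_fun_on A (fst ?c) ?f"
      unfolding smooth_fun_on_def
    proof
      fix d assume d: "d \<in> A"
      have S: "open (snd d ` (fst ?c \<inter> fst d))"
        using d by (intro open_chart_image) auto
      have "smooth_on (snd d ` (fst ?c \<inter> fst d)) (\<lambda>x. (snd ?c \<circ> chart_inv d) x $ i)"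
        using d by (intro smooth_on_bounded_linear[OF bounded_linear_vec_nth S]
            smooth_on_subset[OF transition_smooth]) auto
      then show "smooth_on (snd d ` (fst ?c \<inter> fst d)) (?f \<circ> chart_inv d)"
        by (simp add: comp_def)
    qed
    then have "smooth_fun_near A p ?f"
      unfolding smooth_fun_near_def by (intro exI[of _ "fst ?c"]) (auto intro: open_chart)
    then have "dir_deriv A p w ?f = dir_deriv A p w' ?f"
      using assms unfolding is_lie_bracket_def by simp
    moreover have "dir_deriv A p u ?f = u $ i" for u
    proof -
      have S: "open (snd ?c ` fst ?c)" "snd ?c p \<in> snd ?c ` fst ?c"
        by (auto intro!: open_chart_image)
      have "((\<lambda>x. x $ i) has_derivative (\<lambda>u. u $ i)) (at (snd ?c p))"
        by (intro bounded_linear_imp_has_derivative bounded_linear_vec_nth)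
      then have "((?f \<circ> chart_inv ?c) has_derivative (\<lambda>u. u $ i)) (at (snd ?c p))"
        by (rule has_derivative_transform_within_open[OF _ S]) auto
      from dir_derivI(2)[OF this] show ?thesis .
    qed
    ultimately show ?thesis by simp
  qed
  then show ?thesis by (simp add: vec_eq_iff)
qed

end

section \<open>Connections\<close>

lemma bilinear_sum_sum:
  assumes "bilinear h"
  shows "h (\<Sum>i\<in>S. f i) (\<Sum>j\<in>T. k j) = (\<Sum>i\<in>S. \<Sum>j\<in>T. h (f i) (k j))"
proof -
  have lin: "linear (\<lambda>x. h x y)" "linear (h x)" for x y
    using assms by (auto simp: bilinear_def)
  have "h (\<Sum>i\<in>S. f i) (\<Sum>j\<in>T. k j) = (\<Sum>i\<in>S. h (f i) (\<Sum>j\<in>T. k j))"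
    by (rule linear_sum[OF lin(1)])
  then show ?thesis
    by (simp only: linear_sum[OF lin(2)])
qed

context smooth_manifold3
begin

context
  fixes nabla :: "'m connection"
  assumes conn: "affine_connection A nabla"
begin

lemma nabla_add:
  "vfield_near A p Y \<Longrightarrow> vfield_near A p Z \<Longrightarrow>
    nabla p v (\<lambda>q. Y q + Z q) = nabla p v Y + nabla p v Z"
  using conn by (simp add: affine_connection_def)

lemma nabla_scaleR:
  "smooth_fun_near A p f \<Longrightarrow> vfield_near A p Y \<Longrightarrow>
    nabla p v (\<lambda>q. f q *\<^sub>R Y q) = dir_deriv A p v f *\<^sub>R Y p + f p *\<^sub>R nabla p v Y"
  using conn by (simp add: affine_connection_def)

lemma nabla_zero: "nabla p v (\<lambda>q. 0) = 0"
  using nabla_scaleR[OF smooth_fun_near_const[of p 0] vfield_near_const_field[of p 0], of v] by simp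

text \<open>Multiplying by the indicator function of a neighbourhood, which is smooth near \<open>p\<close>,
  makes locally equal fields globally equal.\<close>

lemma nabla_cong:
  assumes "vfield_near A p X" "open U" "p \<in> U" "\<And>q. q \<in> U \<Longrightarrow> X q = Y q"
  shows "nabla p v X = nabla p v Y"
proof -
  define f where "f q = (if q \<in> U then 1 else (0::real))" for q
  have "smooth_fun_on A U f"
    unfolding smooth_fun_on_def
  proof
    fix c assume c: "c \<in> A"
    then have S: "open (snd c ` (U \<inter> fst c))"
      using assms by (intro open_chart_image) auto
    show "smooth_on (snd c ` (U \<inter> fst c)) (f \<circ> chart_inv c)"
      by (rule smooth_on_cong[OF smooth_on_const[OF S, of 1] S]) (use c in \<open>auto simp: f_def\<close>)
  qed
  then have f: "smooth_fun_near A p f"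
    using assms by (auto simp: smooth_fun_near_def)
  have Y: "vfield_near A p Y"
    by (rule vfield_near_cong[OF assms])
  have "dir_deriv A p v f = dir_deriv A p v (\<lambda>q. 1)"
    by (rule dir_deriv_cong[OF assms(2,3)]) (simp add: f_def)
  then have d: "dir_deriv A p v f = 0" by simp
  have "f p = 1"
    using assms by (simp add: f_def)
  moreover have "(\<lambda>q. f q *\<^sub>R X q) = (\<lambda>q. f q *\<^sub>R Y q)"
    using assms(4) by (auto simp: f_def)
  ultimately show ?thesis
    using nabla_scaleR[OF f assms(1), of v] nabla_scaleR[OF f Y, of v] d by simp
qed

lemma nabla_sum:
  assumes "\<And>j. j \<in> B \<Longrightarrow> smooth_fun_near A p (f j)" "\<And>j. j \<in> B \<Longrightarrow> vfield_near A p (X j)"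
  shows "nabla p v (\<lambda>q. \<Sum>j\<in>B. f j q *\<^sub>R X j q) =
    (\<Sum>j\<in>B. dir_deriv A p v (f j) *\<^sub>R X j p + f j p *\<^sub>R nabla p v (X j))"
  using assms
proof (induction B rule: infinite_finite_induct)
  case (insert x F)
  have "nabla p v (\<lambda>q. f x q *\<^sub>R X x q + (\<Sum>j\<in>F. f j q *\<^sub>R X j q)) =
      nabla p v (\<lambda>q. f x q *\<^sub>R X x q) + nabla p v (\<lambda>q. \<Sum>j\<in>F. f j q *\<^sub>R X j q)"
    using insert.prems by (intro nabla_add vfield_near_sum vfield_near_scaleR) auto
  then show ?case
    using insert by (simp add: nabla_scaleR)
qed (simp_all add: nabla_zero)

text \<open>Leibniz rule for the expansion in the coordinate frame. The result has the same shape as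
  \<open>cov_deriv_along\<close>, which makes the two notions comparable term by term.\<close>

lemma nabla_coord_expansion:
  assumes "vfield_near A p X"
  shows "nabla p v X = (\<Sum>i\<in>UNIV.
      dir_deriv A p v (\<lambda>q. tcoord A (chart_at A p) q (X q) $ i) *\<^sub>R coord_frame A (chart_at A p) i p
      + (X p $ i) *\<^sub>R nabla p v (coord_frame A (chart_at A p) i))"
proof -
  let ?c = "chart_at A p"
  have "nabla p v X = nabla p v (\<lambda>q. \<Sum>i\<in>UNIV. (tcoord A ?c q (X q) $ i) *\<^sub>R coord_frame A ?c i q)"
    by (rule nabla_cong[OF assms, of "fst ?c"]) (auto simp: coord_frame_expansion)
  also have "\<dots> = (\<Sum>i\<in>UNIV.
      dir_deriv A p v (\<lambda>q. tcoord A ?c q (X q) $ i) *\<^sub>R coord_frame A ?c i p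
      + (tcoord A ?c p (X p) $ i) *\<^sub>R nabla p v (coord_frame A ?c i))"
    by (rule nabla_sum) (auto intro: smooth_fun_near_tcoord assms vfield_near_coord_frame)
  finally show ?thesis by simp
qed

text \<open>The components are constant, so only the connection terms survive. These are exactly the
  non-derivative terms of \<open>cov_deriv_along\<close>.\<close>

lemma nabla_const_field:
  "nabla p v (const_field p y) = (\<Sum>i\<in>UNIV. (y $ i) *\<^sub>R nabla p v (coord_frame A (chart_at A p) i))"
proof -
  let ?c = "chart_at A p"
  have "nabla p v (const_field p y) = nabla p v (\<lambda>q. \<Sum>i\<in>UNIV. (y $ i) *\<^sub>R coord_frame A ?c i q)"
    by (rule nabla_cong[OF vfield_near_const_field, of "fst ?c"]) (auto simp: const_field_def tvec_sum)
  then show ?thesis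
    by (simp add: nabla_sum smooth_fun_near_const vfield_near_coord_frame)
qed

end

section \<open>Tensor fields applied to vector fields\<close>

lemma vfield_near_tensor11_coord_frame:
  "tensor11 A T \<Longrightarrow> vfield_near A p (\<lambda>q. T q (coord_frame A (chart_at A p) i q))"
  unfolding vfield_near_def tensor11_def by (meson chart_at_atlas chart_at_mem open_chart)

lemma vfield_near_tensor11:
  assumes "tensor11 A T" "vfield_near A p X"
  shows "vfield_near A p (\<lambda>q. T q (X q))"
proof -
  let ?c = "chart_at A p"
  have "vfield_near A p (\<lambda>q. \<Sum>i\<in>UNIV. (tcoord A ?c q (X q) $ i) *\<^sub>R T q (coord_frame A ?c i q))"
    by (intro vfield_near_sum vfield_near_scaleR smooth_fun_near_tcoord
        vfield_near_tensor11_coord_frame assms)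
  then show ?thesis
  proof (rule vfield_near_cong[of _ _ "fst ?c"])
    fix q assume "q \<in> fst ?c"
    then have "T q (X q) = T q (\<Sum>i\<in>UNIV. (tcoord A ?c q (X q) $ i) *\<^sub>R coord_frame A ?c i q)"
      by (simp add: coord_frame_expansion)
    also have "\<dots> = (\<Sum>i\<in>UNIV. (tcoord A ?c q (X q) $ i) *\<^sub>R T q (coord_frame A ?c i q))"
      using assms(1) by (simp add: tensor11_def linear_sum linear_scale)
    finally show "(\<Sum>i\<in>UNIV. (tcoord A ?c q (X q) $ i) *\<^sub>R T q (coord_frame A ?c i q)) = T q (X q)"
      by simp
  qed auto
qed

lemma tensor02_coord_expansion:
  assumes "tensor02 A B" "c \<in> A" "q \<in> fst c"
  shows "B q x y = (\<Sum>i\<in>UNIV. \<Sum>j\<in>UNIV. (tcoord A c q x $ i) * (tcoord A c q y $ j) *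
    B q (coord_frame A c i q) (coord_frame A c j q))"
proof -
  have B: "bilinear (B q)"
    using assms by (simp add: tensor02_def)
  have "B q x y = B q (\<Sum>i\<in>UNIV. (tcoord A c q x $ i) *\<^sub>R coord_frame A c i q)
      (\<Sum>j\<in>UNIV. (tcoord A c q y $ j) *\<^sub>R coord_frame A c j q)"
    using assms by (simp add: coord_frame_expansion)
  then show ?thesis
    by (simp add: bilinear_sum_sum[OF B] bilinear_lmul[OF B] bilinear_rmul[OF B] ac_simps)
qed

lemma differentiable_tensor02_coord_frame:
  assumes "tensor02 A B"
  shows "differentiable_fun_at p
    (\<lambda>q. B q (coord_frame A (chart_at A p) i q) (coord_frame A (chart_at A p) j q))"
proof (rule smooth_fun_near_imp_differentiable)
  show "smooth_fun_near A p (\<lambda>q. B q (coord_frame A (chart_at A p) i q) (coord_frame A (chart_at A p) j q))"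
    using assms unfolding smooth_fun_near_def tensor02_def
    by (meson chart_at_atlas chart_at_mem open_chart)
qed

lemma differentiable_tensor02:
  assumes "tensor02 A B" "vfield_near A p X" "vfield_near A p Y"
  shows "differentiable_fun_at p (\<lambda>q. B q (X q) (Y q))"
proof -
  let ?c = "chart_at A p"
  have "differentiable_fun_at p (\<lambda>q. \<Sum>i\<in>UNIV. \<Sum>j\<in>UNIV. (tcoord A ?c q (X q) $ i) *
      (tcoord A ?c q (Y q) $ j) * B q (coord_frame A ?c i q) (coord_frame A ?c j q))"
    by (intro differentiable_fun_at_sum differentiable_fun_at_mult smooth_fun_near_imp_differentiable[OF smooth_fun_near_tcoord]
        differentiable_tensor02_coord_frame assms)
  then show ?thesis
    by (rule dir_deriv_cong(2)[of "fst ?c", rotated 3])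
       (auto simp: tensor02_coord_expansion[OF assms(1), of ?c])
qed

end

section \<open>Curves\<close>

locale smooth_curve3 = smooth_manifold3 +
  fixes C :: "real \<Rightarrow> 'a" and I :: "real set"
  assumes curve: "smooth_curve A C I"
begin

abbreviation vel :: "real \<Rightarrow> real^3" where
  "vel \<equiv> velocity A C"

lemma open_interval: "open I" and is_interval: "is_interval I" and interval_nonempty: "I \<noteq> {}"
  using curve by (auto simp: smooth_curve_def)

lemma open_chart_times: "c \<in> A \<Longrightarrow> open {s \<in> I. C s \<in> fst c}"
proof -
  assume "c \<in> A"
  moreover have "continuous_on I C"
    using curve by (simp add: smooth_curve_def)
  ultimately have "open (I \<inter> C -` fst c)"
    using open_interval by (intro continuous_open_preimage) auto
  moreover have "I \<inter> C -` fst c = {s \<in> I. C s \<in> fst c}" by auto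
  ultimately show ?thesis by simp
qed

lemma smooth_chart_curve: "c \<in> A \<Longrightarrow> smooth_on {s \<in> I. C s \<in> fst c} (snd c \<circ> C)"
  using curve by (simp add: smooth_curve_def)

lemma velocity_has_derivative:
  assumes "t \<in> I"
  shows "((snd (chart_at A (C t)) \<circ> C) has_derivative (\<lambda>h. h *\<^sub>R vel t)) (at t)"
proof -
  let ?c = "chart_at A (C t)"
  have "(snd ?c \<circ> C) differentiable (at t)"
    using smooth_on_differentiable[OF smooth_chart_curve, of ?c t] assms by simp
  then show ?thesis
    unfolding velocity_def using vector_derivative_works has_vector_derivative_def by blast
qed

lemma DERIV_along:
  assumes "t \<in> I" "differentiable_fun_at (C t) f"
  shows "((\<lambda>s. f (C s)) has_real_derivative dir_deriv A (C t) (vel t) f) (at t)"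
proof -
  let ?c = "chart_at A (C t)"
  note f' = differentiable_fun_at_has_derivative[OF assms(2)]
  have "((\<lambda>s. (f \<circ> chart_inv ?c) ((snd ?c \<circ> C) s)) has_derivative
      (\<lambda>h. dir_deriv A (C t) (h *\<^sub>R vel t) f)) (at t)"
    by (rule has_derivative_compose[OF velocity_has_derivative[OF assms(1)]]) (use f' in \<open>simp add: comp_def\<close>)
  then have "((\<lambda>s. f (C s)) has_derivative (\<lambda>h. dir_deriv A (C t) (h *\<^sub>R vel t) f)) (at t)"
    by (rule has_derivative_transform_within_open[OF _ open_chart_times[of ?c]]) (use assms in auto)
  moreover have "dir_deriv A (C t) (h *\<^sub>R vel t) f = dir_deriv A (C t) (vel t) f * h" for h
    using linear_scale[OF has_derivative_linear[OF f'], of h "vel t"] by simp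
  ultimately show ?thesis
    by (simp add: has_field_derivative_def)
qed

text \<open>\<open>velocity\<close> is computed in a chart that may change with \<open>t\<close>.
  Read in one fixed chart it is the ordinary derivative of the coordinate curve, and this is what
  makes it smooth.\<close>

lemma tcoord_velocity:
  assumes "c \<in> A" "t \<in> I" "C t \<in> fst c"
  shows "tcoord A c (C t) (vel t) = frechet_derivative (snd c \<circ> C) (at t) 1"
proof -
  let ?d = "chart_at A (C t)"
  have "((\<lambda>s. (snd c \<circ> chart_inv ?d) ((snd ?d \<circ> C) s)) has_derivative
      (\<lambda>h. tcoord A c (C t) (h *\<^sub>R vel t))) (at t)"
    unfolding tcoord_def
    by (rule has_derivative_compose[OF velocity_has_derivative[OF assms(2)]])
       (use transition_has_derivative[of ?d c "C t"] assms in \<open>simp add: comp_def\<close>)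
  then have "((snd c \<circ> C) has_derivative (\<lambda>h. tcoord A c (C t) (h *\<^sub>R vel t))) (at t)"
    by (rule has_derivative_transform_within_open[OF _ open_chart_times[of ?d]]) (use assms in auto)
  from frechet_derivative_at[OF this] have "tcoord A c (C t) (1 *\<^sub>R vel t) =
      frechet_derivative (snd c \<circ> C) (at t) 1" by metis
  then show ?thesis by simp
qed

section \<open>Smooth vector fields along a curve\<close>

lemma vfield_along_velocity: "vfield_along A C I vel"
  unfolding vfield_along_def
proof
  fix c assume c: "c \<in> A"
  show "smooth_on {t \<in> I. C t \<in> fst c} (\<lambda>s. tcoord A c (C s) (vel s))"
    by (rule smooth_on_cong[OF smooth_on_frechet_derivative[OF smooth_chart_curve[OF c]]
          open_chart_times[OF c]]) (use c tcoord_velocity in auto)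
qed

lemma vfield_along_field:
  assumes "vfield_on A UNIV X"
  shows "vfield_along A C I (\<lambda>s. X (C s))"
  unfolding vfield_along_def
proof
  fix c assume c: "c \<in> A"
  let ?S = "{t \<in> I. C t \<in> fst c}"
  have "smooth_on (snd c ` fst c) ((\<lambda>q. tcoord A c q (X q)) \<circ> chart_inv c)"
    using assms c by (simp add: vfield_on_def)
  then have "smooth_on ?S (\<lambda>s. ((\<lambda>q. tcoord A c q (X q)) \<circ> chart_inv c) ((snd c \<circ> C) s))"
    by (rule smooth_on_compose[OF _ smooth_chart_curve[OF c] open_chart_times[OF c]]) auto
  then show "smooth_on ?S (\<lambda>s. tcoord A c (C s) (X (C s)))"
    by (rule smooth_on_cong[OF _ open_chart_times[OF c]]) (use c in auto)
qed

lemma vfield_along_add: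
  assumes "vfield_along A C I V" "vfield_along A C I W"
  shows "vfield_along A C I (\<lambda>s. V s + W s)"
  unfolding vfield_along_def
proof
  fix c assume c: "c \<in> A"
  show "smooth_on {t \<in> I. C t \<in> fst c} (\<lambda>s. tcoord A c (C s) (V s + W s))"
    by (rule smooth_on_cong[OF smooth_on_add[OF open_chart_times[OF c]] open_chart_times[OF c]])
       (use assms c in \<open>auto simp: vfield_along_def linear_add[OF linear_tcoord]\<close>)
qed

lemma vfield_along_scaleR:
  assumes "vfield_along A C I V"
  shows "vfield_along A C I (\<lambda>s. r *\<^sub>R V s)"
  unfolding vfield_along_def
proof
  fix c assume c: "c \<in> A"
  show "smooth_on {t \<in> I. C t \<in> fst c} (\<lambda>s. tcoord A c (C s) (r *\<^sub>R V s))"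
    by (rule smooth_on_cong[OF smooth_on_bounded_linear[OF bounded_linear_scaleR_right[of r]
            open_chart_times[OF c]] open_chart_times[OF c]])
       (use assms c in \<open>auto simp: vfield_along_def linear_scale[OF linear_tcoord]\<close>)
qed

lemma vfield_along_tensor11:
  assumes T: "tensor11 A T" and V: "vfield_along A C I V"
  shows "vfield_along A C I (\<lambda>s. T (C s) (V s))"
  unfolding vfield_along_def
proof
  fix c assume c: "c \<in> A"
  let ?S = "{t \<in> I. C t \<in> fst c}"
  let ?X = "\<lambda>i q. T q (coord_frame A c i q)"
  note S = open_chart_times[OF c]
  have "smooth_on (snd c ` fst c) ((\<lambda>q. tcoord A c q (?X i q)) \<circ> chart_inv c)" for i
    using T c by (auto simp: tensor11_def vfield_on_def dest!: bspec)
  then have "smooth_on ?S (\<lambda>s. ((\<lambda>q. tcoord A c q (?X i q)) \<circ> chart_inv c) ((snd c \<circ> C) s))" for i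
    by (rule smooth_on_compose[OF _ smooth_chart_curve[OF c] S]) auto
  moreover have "smooth_on ?S (\<lambda>s. tcoord A c (C s) (V s) $ i)" for i
    using V c by (intro smooth_on_bounded_linear[OF bounded_linear_vec_nth S]) (simp add: vfield_along_def)
  ultimately have "smooth_on ?S (\<lambda>s. \<Sum>i\<in>UNIV. (tcoord A c (C s) (V s) $ i) *\<^sub>R
      ((\<lambda>q. tcoord A c q (?X i q)) \<circ> chart_inv c) ((snd c \<circ> C) s))"
    by (intro smooth_on_sum smooth_on_scaleR S)
  then show "smooth_on ?S (\<lambda>s. tcoord A c (C s) (T (C s) (V s)))"
  proof (rule smooth_on_cong[OF _ S])
    fix s assume s: "s \<in> ?S"
    have lin: "linear (T (C s))" "linear (tcoord A c (C s))"
      using T s c by (auto simp: tensor11_def intro: linear_tcoord)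
    have "tcoord A c (C s) (T (C s) (V s)) = tcoord A c (C s) (T (C s)
        (\<Sum>i\<in>UNIV. (tcoord A c (C s) (V s) $ i) *\<^sub>R coord_frame A c i (C s)))"
      using s c by (simp add: coord_frame_expansion)
    then show "(\<Sum>i\<in>UNIV. (tcoord A c (C s) (V s) $ i) *\<^sub>R
      ((\<lambda>q. tcoord A c q (?X i q)) \<circ> chart_inv c) ((snd c \<circ> C) s)) = tcoord A c (C s) (T (C s) (V s))"
      using s c by (simp add: linear_sum[OF lin(1)] linear_scale[OF lin(1)]
          linear_sum[OF lin(2)] linear_scale[OF lin(2)])
  qed
qed

lemma DERIV_vfield_along:
  assumes "vfield_along A C I V" "t \<in> I"
  shows "((\<lambda>s. tcoord A (chart_at A (C t)) (C s) (V s) $ i) has_real_derivative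
    deriv (\<lambda>s. tcoord A (chart_at A (C t)) (C s) (V s) $ i) t) (at t)"
proof -
  let ?c = "chart_at A (C t)"
  have "smooth_on {s \<in> I. C s \<in> fst ?c} (\<lambda>s. tcoord A ?c (C s) (V s) $ i)"
    using assms(1) by (intro smooth_on_bounded_linear[OF bounded_linear_vec_nth] open_chart_times)
      (auto simp: vfield_along_def)
  then have "(\<lambda>s. tcoord A ?c (C s) (V s) $ i) differentiable (at t)"
    by (rule smooth_on_differentiable) (use assms in auto)
  then show ?thesis
    using real_differentiable_def DERIV_deriv_iff_real_differentiable by blast
qed

text \<open>Only affine changes of parameter occur, since the velocity has constant length for the
  associated metric. Nothing is known of \<open>\<gamma>\<close> off \<open>J\<close>, so each
  derivative is transferred from \<open>C\<close> composed with the inverse map \<open>h\<close> on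
  an open set of parameters.\<close>

lemma affine_reparameterization:
  assumes r: "r > 0" and J: "J = (\<lambda>t. r * t + r0) ` I" and \<gamma>: "\<And>t. t \<in> I \<Longrightarrow> \<gamma> (r * t + r0) = C t"
  shows "smooth_curve A \<gamma> J" "t \<in> I \<Longrightarrow> velocity A \<gamma> (r * t + r0) = (1 / r) *\<^sub>R vel t"
proof -
  \<comment> \<open>The inverse of the affine map, written as a linear term plus a constant so that
    the closure rules for smooth maps apply.\<close>
  define h where "h s = (1 / r) * s + - r0 / r" for s
  have h_inv: "h (r * t + r0) = t" "r * h s + r0 = s" for s t
    using r by (simp_all add: h_def field_simps)
  have mem: "s \<in> J \<longleftrightarrow> h s \<in> I" for s
    unfolding J using h_inv by (metis (no_types, lifting) imageE image_eqI)
  have \<gamma>_eq: "\<gamma> s = C (h s)" if "s \<in> J" for s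
    using that mem \<gamma>[of "h s"] h_inv by simp
  have cont_h: "continuous_on S h" for S
    unfolding h_def by (intro continuous_intros)
  have vimage: "open (h -` S)" if "open S" for S
    using that cont_h by (intro open_vimage) auto
  let ?T = "\<lambda>d. h -` {t \<in> I. C t \<in> fst d}"
  have T: "{s \<in> J. \<gamma> s \<in> fst d} = ?T d" for d :: "'a chart"
    using mem \<gamma>_eq by auto
  have T_open: "open (?T d)" if "d \<in> A" for d
    using vimage open_chart_times[OF that] by blast
  show "smooth_curve A \<gamma> J"
    unfolding smooth_curve_def
  proof (intro conjI ballI)
    have "J = h -` I"
      using mem by blast
    then show "open J"
      using vimage open_interval by simp
    have "connected J"
      unfolding J using is_interval
      by (intro connected_continuous_image continuous_intros) (simp add: is_interval_connected)
    then show "is_interval J"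
      by (simp add: is_interval_connected_1)
    show "J \<noteq> {}"
      using J interval_nonempty by simp
    have "continuous_on I C"
      using curve by (simp add: smooth_curve_def)
    then have "continuous_on J (\<lambda>s. C (h s))"
      by (rule continuous_on_compose2[OF _ cont_h]) (use mem in auto)
    then show "continuous_on J \<gamma>"
      using \<gamma>_eq by (metis continuous_on_cong)
    fix d assume d: "d \<in> A"
    have "smooth_on (?T d) h"
      unfolding h_def[abs_def]
      by (intro smooth_on_add smooth_on_bounded_linear[OF bounded_linear_mult_right] smooth_on_ident
          smooth_on_const T_open[OF d, unfolded h_def[abs_def]])
    then have "smooth_on (?T d) (\<lambda>s. (snd d \<circ> C) (h s))"
      by (rule smooth_on_compose[OF smooth_chart_curve[OF d] _ T_open[OF d]]) auto
    then have "smooth_on (?T d) (snd d \<circ> \<gamma>)"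
      by (rule smooth_on_cong[OF _ T_open[OF d]]) (use mem \<gamma>_eq in auto)
    then show "smooth_on {s \<in> J. \<gamma> s \<in> fst d} (snd d \<circ> \<gamma>)"
      by (simp add: T)
  qed
  show "velocity A \<gamma> (r * t + r0) = (1 / r) *\<^sub>R vel t" if t: "t \<in> I"
  proof -
    let ?c = "chart_at A (C t)" and ?s = "r * t + r0"
    have "(h has_derivative (\<lambda>k. (1 / r) * k)) (at ?s)"
      unfolding h_def using r by (auto intro!: derivative_eq_intros)
    then have "((\<lambda>s. (snd ?c \<circ> C) (h s)) has_derivative (\<lambda>k. ((1 / r) * k) *\<^sub>R vel t)) (at ?s)"
      by (rule has_derivative_compose) (use velocity_has_derivative[OF t] h_inv in \<open>simp add: comp_def\<close>)
    then have "((snd ?c \<circ> \<gamma>) has_derivative (\<lambda>k. ((1 / r) * k) *\<^sub>R vel t)) (at ?s)"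
      by (rule has_derivative_transform_within_open[OF _ T_open[of ?c]])
         (use t h_inv mem \<gamma>_eq in auto)
    then have "((snd ?c \<circ> \<gamma>) has_vector_derivative (1 / r) *\<^sub>R vel t) (at ?s)"
      by (simp add: has_vector_derivative_def mult.commute)
    then show ?thesis
      using \<gamma>[OF t] by (simp add: velocity_def vector_derivative_at)
  qed
qed

text \<open>Leibniz rule along the curve: expand every \<open>X j\<close> in the coordinate frame at
  \<open>C t\<close>, differentiate the components, and exchange the two sums. Restrictions of
  fields and images under (1,1)-tensors are both special cases.\<close>

lemma cov_deriv_along_combination:
  assumes conn: "affine_connection A nabla" and t: "t \<in> I" and U: "open U" "t \<in> U"
    and V: "\<And>s. s \<in> U \<Longrightarrow> s \<in> I \<Longrightarrow> V s = (\<Sum>j\<in>B. f j s *\<^sub>R X j (C s))"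
    and f: "\<And>j. j \<in> B \<Longrightarrow> (f j has_real_derivative f' j) (at t)"
    and X: "\<And>j. j \<in> B \<Longrightarrow> vfield_near A (C t) (X j)"
  shows "cov_deriv_along A nabla C V t =
    (\<Sum>j\<in>B. f' j *\<^sub>R X j (C t) + f j t *\<^sub>R nabla (C t) (vel t) (X j))"
proof -
  let ?c = "chart_at A (C t)" and ?p = "C t"
  let ?e = "coord_frame A ?c"
  define x where "x j i q = tcoord A ?c q (X j q) $ i" for j i q
  define x' where "x' j i = dir_deriv A ?p (vel t) (x j i)" for j i
  have x_t: "x j i ?p = X j ?p $ i" for j i
    by (simp add: x_def)
  have "((\<lambda>s. x j i (C s)) has_real_derivative x' j i) (at t)" if "j \<in> B" for i j
    unfolding x'_def x_def
    by (intro DERIV_along[OF t] smooth_fun_near_imp_differentiable smooth_fun_near_tcoord X that)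
  then have sum_deriv: "((\<lambda>s. \<Sum>j\<in>B. f j s * x j i (C s)) has_real_derivative
      (\<Sum>j\<in>B. f' j * x j i ?p + x' j i * f j t)) (at t)" for i
    by (intro DERIV_sum DERIV_mult f)
  let ?U = "U \<inter> {s \<in> I. C s \<in> fst ?c}"
  have lin: "tcoord A ?c (C s) (V s) $ i = (\<Sum>j\<in>B. f j s * x j i (C s))" if "s \<in> ?U" for s i
  proof -
    have "linear (tcoord A ?c (C s))"
      using that by (intro linear_tcoord) auto
    then show ?thesis
      using that by (simp add: V x_def linear_sum linear_scale)
  qed
  have "((\<lambda>s. tcoord A ?c (C s) (V s) $ i) has_real_derivative
      (\<Sum>j\<in>B. f' j * x j i ?p + x' j i * f j t)) (at t)" for i
    by (rule has_field_derivative_transform_within_open[OF sum_deriv, of ?U])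
       (use U t open_chart_times[of ?c] lin in \<open>auto intro!: open_Int\<close>)
  from DERIV_imp_deriv[OF this]
  have "cov_deriv_along A nabla C V t = (\<Sum>i\<in>UNIV.
      (\<Sum>j\<in>B. f' j * x j i ?p + x' j i * f j t) *\<^sub>R ?e i ?p
      + (\<Sum>j\<in>B. f j t * x j i ?p) *\<^sub>R nabla ?p (vel t) (?e i))"
    using lin[of t] U t by (simp add: cov_deriv_along_def Let_def)
  also have "\<dots> = (\<Sum>i\<in>UNIV. \<Sum>j\<in>B. f' j *\<^sub>R (x j i ?p *\<^sub>R ?e i ?p)
      + f j t *\<^sub>R (x' j i *\<^sub>R ?e i ?p + x j i ?p *\<^sub>R nabla ?p (vel t) (?e i)))"
    by (simp add: scaleR_sum_left sum.distrib scaleR_add_left scaleR_add_right ac_simps)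
  also have "\<dots> = (\<Sum>j\<in>B. f' j *\<^sub>R (\<Sum>i\<in>UNIV. x j i ?p *\<^sub>R ?e i ?p)
      + f j t *\<^sub>R (\<Sum>i\<in>UNIV. x' j i *\<^sub>R ?e i ?p + x j i ?p *\<^sub>R nabla ?p (vel t) (?e i)))"
    by (subst sum.swap) (simp add: sum.distrib scaleR_sum_right scaleR_add_right)
  also have "\<dots> = (\<Sum>j\<in>B. f' j *\<^sub>R X j ?p + f j t *\<^sub>R nabla ?p (vel t) (X j))"
  proof (rule sum.cong[OF refl])
    fix j assume "j \<in> B"
    then have "nabla ?p (vel t) (X j) =
        (\<Sum>i\<in>UNIV. x' j i *\<^sub>R ?e i ?p + x j i ?p *\<^sub>R nabla ?p (vel t) (?e i))"
      using nabla_coord_expansion[OF conn X] by (simp add: x_t x'_def x_def[abs_def])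
    moreover have "(\<Sum>i\<in>UNIV. x j i ?p *\<^sub>R ?e i ?p) = X j ?p"
      unfolding x_def by (rule coord_frame_expansion) auto
    ultimately show "f' j *\<^sub>R (\<Sum>i\<in>UNIV. x j i ?p *\<^sub>R ?e i ?p)
      + f j t *\<^sub>R (\<Sum>i\<in>UNIV. x' j i *\<^sub>R ?e i ?p + x j i ?p *\<^sub>R nabla ?p (vel t) (?e i))
      = f' j *\<^sub>R X j ?p + f j t *\<^sub>R nabla ?p (vel t) (X j)"
      by simp
  qed
  finally show ?thesis .
qed

lemma cov_deriv_along_field:
  assumes "affine_connection A nabla" "t \<in> I" "vfield_near A (C t) X"
  shows "cov_deriv_along A nabla C (\<lambda>s. X (C s)) t = nabla (C t) (vel t) X"
  using cov_deriv_along_combination[OF assms(1,2) open_UNIV, where B="{()}" and f="\<lambda>_ _. 1" and f'="\<lambda>_. 0"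
      and X="\<lambda>_. X"] assms(3) by simp

text \<open>\<open>deriv\<close> sees a neighbourhood of \<open>t\<close>, which the open interval
  provides. It serves to replace the fields of an arbitrary Frenet apparatus, constrained only on
  the parameter interval.\<close>

lemma cov_deriv_along_cong:
  assumes "t \<in> I" "\<And>s. s \<in> I \<Longrightarrow> V s = W s"
  shows "cov_deriv_along A nabla C V t = cov_deriv_along A nabla C W t"
proof -
  let ?v = "\<lambda>V i s. tcoord A (chart_at A (C t)) (C s) (V s) $ i"
  have "\<forall>\<^sub>F s in nhds t. ?v V i s = ?v W i s" for i
    using open_interval assms by (auto simp: eventually_nhds)
  then have "deriv (?v V i) t = deriv (?v W i) t" for i
    by (rule deriv_cong_ev) simp
  then show ?thesis
    using assms by (simp add: cov_deriv_along_def Let_def)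
qed

lemma cov_deriv_along_add:
  assumes "vfield_along A C I V" "vfield_along A C I W" "t \<in> I"
  shows "cov_deriv_along A nabla C (\<lambda>s. V s + W s) t =
    cov_deriv_along A nabla C V t + cov_deriv_along A nabla C W t"
proof -
  let ?c = "chart_at A (C t)"
  let ?v = "\<lambda>V i s. tcoord A ?c (C s) (V s) $ i"
  have "((\<lambda>s. ?v V i s + ?v W i s) has_real_derivative deriv (?v V i) t + deriv (?v W i) t) (at t)" for i
    by (intro DERIV_add DERIV_vfield_along assms)
  then have "(?v (\<lambda>s. V s + W s) i has_real_derivative deriv (?v V i) t + deriv (?v W i) t) (at t)" for i
    by (rule has_field_derivative_transform_within_open[OF _ open_chart_times[of ?c]])
       (use assms in \<open>auto simp: linear_add[OF linear_tcoord]\<close>)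
  from DERIV_imp_deriv[OF this] show ?thesis
    by (simp add: cov_deriv_along_def Let_def sum.distrib scaleR_add_left)
qed

lemma cov_deriv_along_scaleR:
  assumes "vfield_along A C I V" "t \<in> I"
  shows "cov_deriv_along A nabla C (\<lambda>s. r *\<^sub>R V s) t = r *\<^sub>R cov_deriv_along A nabla C V t"
proof -
  let ?c = "chart_at A (C t)"
  let ?v = "\<lambda>V i s. tcoord A ?c (C s) (V s) $ i"
  have "((\<lambda>s. r * ?v V i s) has_real_derivative r * deriv (?v V i) t) (at t)" for i
    by (intro DERIV_cmult DERIV_vfield_along assms)
  then have "(?v (\<lambda>s. r *\<^sub>R V s) i has_real_derivative r * deriv (?v V i) t) (at t)" for i
    by (rule has_field_derivative_transform_within_open[OF _ open_chart_times[of ?c]])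
       (use assms in \<open>auto simp: linear_scale[OF linear_tcoord]\<close>)
  from DERIV_imp_deriv[OF this] show ?thesis
    by (simp add: cov_deriv_along_def Let_def scaleR_sum_right scaleR_add_right)
qed

text \<open>The derivatives of the components cancel, so the difference depends on \<open>V\<close>
  only through \<open>V t\<close>, which \<open>const_field\<close> then represents.\<close>

lemma cov_deriv_along_diff_connection:
  assumes "affine_connection A nabla" "affine_connection A nabla'"
  shows "cov_deriv_along A nabla' C V t = cov_deriv_along A nabla C V t
    + (nabla' (C t) (vel t) (const_field (C t) (V t)) - nabla (C t) (vel t) (const_field (C t) (V t)))"
  by (simp add: cov_deriv_along_def Let_def nabla_const_field[OF assms(1)]
      nabla_const_field[OF assms(2)] sum.distrib)

text \<open>The bracketed correction is the covariant derivative of \<open>T\<close> in direction of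
  the velocity, applied to \<open>V t\<close>. For \<phi> it is the expression that the F4 condition
  makes explicit.\<close>

lemma cov_deriv_along_tensor11:
  assumes conn: "affine_connection A nabla" and T: "tensor11 A T" and V: "vfield_along A C I V"
    and t: "t \<in> I"
  shows "cov_deriv_along A nabla C (\<lambda>s. T (C s) (V s)) t = T (C t) (cov_deriv_along A nabla C V t)
    + (nabla (C t) (vel t) (\<lambda>q. T q (const_field (C t) (V t) q))
       - T (C t) (nabla (C t) (vel t) (const_field (C t) (V t))))"
proof -
  let ?c = "chart_at A (C t)" and ?p = "C t"
  let ?e = "coord_frame A ?c"
  define v where "v i s = tcoord A ?c (C s) (V s) $ i" for i s
  have lin: "linear (T q)" for q
    using T by (simp add: tensor11_def)
  note T_linear = linear_sum[OF lin] linear_scale[OF lin] linear_add[OF lin]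
  have Te: "vfield_near A ?p (\<lambda>q. T q (?e i q))" for i
    by (rule vfield_near_tensor11_coord_frame[OF T])
  have "cov_deriv_along A nabla C (\<lambda>s. T (C s) (V s)) t =
      (\<Sum>i\<in>UNIV. deriv (v i) t *\<^sub>R T ?p (?e i ?p) + v i t *\<^sub>R nabla ?p (vel t) (\<lambda>q. T q (?e i q)))"
  proof (rule cov_deriv_along_combination[OF conn t open_chart_times[of ?c]])
    fix s assume "s \<in> {s \<in> I. C s \<in> fst ?c}"
    then have "V s = (\<Sum>i\<in>UNIV. v i s *\<^sub>R ?e i (C s))"
      by (simp add: v_def coord_frame_expansion)
    then have "T (C s) (V s) = T (C s) (\<Sum>i\<in>UNIV. v i s *\<^sub>R ?e i (C s))"
      by simp
    then show "T (C s) (V s) = (\<Sum>i\<in>UNIV. v i s *\<^sub>R T (C s) (?e i (C s)))"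
      by (simp add: T_linear)
  qed (use t Te DERIV_vfield_along[OF V t] in \<open>auto simp: v_def[abs_def]\<close>)
  moreover have "(\<Sum>i\<in>UNIV. v i t *\<^sub>R nabla ?p (vel t) (\<lambda>q. T q (?e i q))) =
      nabla ?p (vel t) (\<lambda>q. T q (const_field ?p (V t) q))"
  proof -
    have "(\<Sum>i\<in>UNIV. v i t *\<^sub>R nabla ?p (vel t) (\<lambda>q. T q (?e i q))) =
        nabla ?p (vel t) (\<lambda>q. \<Sum>i\<in>UNIV. v i t *\<^sub>R T q (?e i q))"
      by (simp add: nabla_sum[OF conn] smooth_fun_near_const Te)
    also have "\<dots> = nabla ?p (vel t) (\<lambda>q. T q (const_field ?p (V t) q))"
      by (rule nabla_cong[OF conn, of _ _ "fst ?c"])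
         (auto intro!: vfield_near_sum vfield_near_scaleR smooth_fun_near_const Te
           simp: const_field_def tvec_sum T_linear v_def)
    finally show ?thesis .
  qed
  moreover have "T ?p (cov_deriv_along A nabla C V t) =
      (\<Sum>i\<in>UNIV. deriv (v i) t *\<^sub>R T ?p (?e i ?p)) + T ?p (nabla ?p (vel t) (const_field ?p (V t)))"
    by (simp add: cov_deriv_along_def Let_def sum.distrib T_linear nabla_const_field[OF conn] v_def[abs_def])
  ultimately show ?thesis
    by (simp add: sum.distrib)
qed

text \<open>Product rule for the component expansion of the metric. Compatibility of the connection
  supplies the derivatives \<open>G'\<close> of the coefficients in the coordinate frame, and
  bilinearity regroups the terms.\<close>

lemma DERIV_metric_along:
  assumes lc: "levi_civita A g nabla" and g: "tensor02 A g" and t: "t \<in> I"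
    and V: "vfield_along A C I V" and W: "vfield_along A C I W"
  shows "((\<lambda>s. g (C s) (V s) (W s)) has_real_derivative
    g (C t) (cov_deriv_along A nabla C V t) (W t) + g (C t) (V t) (cov_deriv_along A nabla C W t)) (at t)"
proof -
  let ?c = "chart_at A (C t)" and ?p = "C t"
  let ?e = "coord_frame A ?c"
  define v where "v i s = tcoord A ?c (C s) (V s) $ i" for i s
  define w where "w i s = tcoord A ?c (C s) (W s) $ i" for i s
  define N where "N i = nabla ?p (vel t) (?e i)" for i
  define G' where "G' i j = g ?p (N i) (?e j ?p) + g ?p (?e i ?p) (N j)" for i j
  have B: "bilinear (g ?p)"
    using g by (simp add: tensor02_def)
  note g_linear = bilinear_sum_sum[OF B] bilinear_lmul[OF B] bilinear_rmul[OF B]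
    bilinear_ladd[OF B] bilinear_radd[OF B]
  have V_t: "V t = (\<Sum>i\<in>UNIV. v i t *\<^sub>R ?e i ?p)" and W_t: "W t = (\<Sum>i\<in>UNIV. w i t *\<^sub>R ?e i ?p)"
    using coord_frame_expansion[of ?c ?p "V t"] coord_frame_expansion[of ?c ?p "W t"]
    by (simp_all add: v_def w_def)
  have DV: "cov_deriv_along A nabla C V t = (\<Sum>i\<in>UNIV. deriv (v i) t *\<^sub>R ?e i ?p + v i t *\<^sub>R N i)"
    and DW: "cov_deriv_along A nabla C W t = (\<Sum>i\<in>UNIV. deriv (w i) t *\<^sub>R ?e i ?p + w i t *\<^sub>R N i)"
    by (simp_all add: cov_deriv_along_def Let_def v_def[abs_def] w_def[abs_def] N_def)
  have "((\<lambda>s. g (C s) (?e i (C s)) (?e j (C s))) has_real_derivative G' i j) (at t)" for i j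
    using DERIV_along[OF t differentiable_tensor02_coord_frame[OF g], of i j] lc
      vfield_near_coord_frame unfolding levi_civita_def by (simp add: G'_def N_def)
  moreover have "(v i has_real_derivative deriv (v i) t) (at t)"
      "(w i has_real_derivative deriv (w i) t) (at t)" for i
    unfolding v_def[abs_def] w_def[abs_def] by (intro DERIV_vfield_along V W t)+
  ultimately have "((\<lambda>s. \<Sum>i\<in>UNIV. \<Sum>j\<in>UNIV. v i s * w j s * g (C s) (?e i (C s)) (?e j (C s)))
      has_real_derivative (\<Sum>i\<in>UNIV. \<Sum>j\<in>UNIV. (deriv (v i) t * w j t + deriv (w j) t * v i t)
        * g ?p (?e i ?p) (?e j ?p) + G' i j * (v i t * w j t))) (at t)"
    by (intro DERIV_sum DERIV_mult)
  then have "((\<lambda>s. g (C s) (V s) (W s)) has_real_derivative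
      (\<Sum>i\<in>UNIV. \<Sum>j\<in>UNIV. (deriv (v i) t * w j t + deriv (w j) t * v i t)
        * g ?p (?e i ?p) (?e j ?p) + G' i j * (v i t * w j t))) (at t)"
    by (rule has_field_derivative_transform_within_open[OF _ open_chart_times[of ?c]])
       (use t in \<open>auto simp: tensor02_coord_expansion[OF g, of ?c] v_def w_def\<close>)
  moreover have "(\<Sum>i\<in>UNIV. \<Sum>j\<in>UNIV. (deriv (v i) t * w j t + deriv (w j) t * v i t)
        * g ?p (?e i ?p) (?e j ?p) + G' i j * (v i t * w j t)) =
      g ?p (cov_deriv_along A nabla C V t) (W t) + g ?p (V t) (cov_deriv_along A nabla C W t)"
    unfolding DV DW V_t W_t g_linear sum.distrib[symmetric] G'_def
    by (intro sum.cong refl) (simp add: algebra_simps)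
  ultimately show ?thesis by simp
qed

end

section \<open>The class F4\<close>

locale F4_manifold3 =
  fixes A :: "'m::{t2_space,second_countable_topology} chart set"
    and \<phi> :: "'m \<Rightarrow> real^3 \<Rightarrow> real^3" and \<xi> :: "'m \<Rightarrow> real^3"
    and \<eta> :: "'m \<Rightarrow> real^3 \<Rightarrow> real" and g :: "'m \<Rightarrow> real^3 \<Rightarrow> real^3 \<Rightarrow> real"
    and nabla :: "'m connection"
  assumes F4: "F4_manifold A \<phi> \<xi> \<eta> g nabla"
begin

lemma B_metric: "almost_contact_B_metric A \<phi> \<xi> \<eta> g" and levi_civita: "levi_civita A g nabla"
  using F4 by (simp_all add: F4_manifold_def)

sublocale smooth_manifold3 A
  using B_metric by unfold_locales (simp add: almost_contact_B_metric_def)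

lemma connection: "affine_connection A nabla"
  using levi_civita by (simp add: levi_civita_def)

lemma phi_tensor: "tensor11 A \<phi>" and xi_field: "vfield_on A UNIV \<xi>"
  and eta_one_form: "one_form A \<eta>" and metric: "semi_riemannian_metric A g"
  and phi_phi: "\<phi> p (\<phi> p x) = - x + \<eta> p x *\<^sub>R \<xi> p"
  and eta_xi [simp]: "\<eta> p (\<xi> p) = 1"
  and g_phi_phi: "g p (\<phi> p x) (\<phi> p y) = - g p x y + \<eta> p x * \<eta> p y"
  using B_metric by (simp_all add: almost_contact_B_metric_def)

lemma g_tensor: "tensor02 A g" and g_sym: "g p x y = g p y x"
  and g_nondegenerate: "(\<And>y. g p x y = 0) \<Longrightarrow> x = 0"
  using metric unfolding semi_riemannian_metric_def by blast+

lemma linear_phi: "linear (\<phi> p)" and linear_eta: "linear (\<eta> p)" and bilinear_g: "bilinear (g p)"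
  using phi_tensor eta_one_form g_tensor by (simp_all add: tensor11_def one_form_def tensor02_def)

lemmas phi_linear = linear_add[OF linear_phi] linear_diff[OF linear_phi] linear_scale[OF linear_phi]
  linear_neg[OF linear_phi] linear_0[OF linear_phi]

lemmas eta_linear = linear_add[OF linear_eta] linear_diff[OF linear_eta] linear_scale[OF linear_eta]
  linear_neg[OF linear_eta] linear_0[OF linear_eta]

lemmas g_linear = bilinear_ladd[OF bilinear_g] bilinear_radd[OF bilinear_g]
  bilinear_lsub[OF bilinear_g] bilinear_rsub[OF bilinear_g]
  bilinear_lmul[OF bilinear_g] bilinear_rmul[OF bilinear_g]
  bilinear_lneg[OF bilinear_g] bilinear_rneg[OF bilinear_g]
  bilinear_lzero[OF bilinear_g] bilinear_rzero[OF bilinear_g]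

text \<open>\<phi>\<phi>\<xi> = 0, so \<phi>\<phi>(\<phi>\<xi>) = 0 as well, and the structure
  equation at \<phi>\<xi> gives \<phi>\<xi> = c \<xi>. Applying \<phi> once more gives c^2 \<xi> =
  0, hence c = 0.\<close>

lemma phi_xi [simp]: "\<phi> p (\<xi> p) = 0"
proof -
  have xi: "\<xi> p \<noteq> 0"
    using eta_xi[of p] eta_linear(5) by force
  have "\<phi> p (\<phi> p (\<xi> p)) = 0"
    by (simp add: phi_phi)
  then have phi: "\<phi> p (\<xi> p) = \<eta> p (\<phi> p (\<xi> p)) *\<^sub>R \<xi> p"
    using phi_phi[of p "\<phi> p (\<xi> p)"] by (simp add: phi_linear)
  then have "\<phi> p (\<phi> p (\<xi> p)) = (\<eta> p (\<phi> p (\<xi> p)) * \<eta> p (\<phi> p (\<xi> p))) *\<^sub>R \<xi> p"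
    by (metis phi_linear(3) scaleR_scaleR)
  then show ?thesis
    using \<open>\<phi> p (\<phi> p (\<xi> p)) = 0\<close> xi phi by simp
qed

text \<open>Two computations of the cube of \<phi>: applying \<phi> to the structure equation at
  \<open>x\<close>, and using that equation at \<open>\<phi> p x\<close>. They differ by a multiple
  of \<xi>.\<close>

lemma eta_phi [simp]: "\<eta> p (\<phi> p x) = 0"
proof -
  have "\<phi> p (\<phi> p (\<phi> p x)) = - \<phi> p x"
    by (simp add: phi_phi[of p x] phi_linear)
  then have "\<eta> p (\<phi> p x) *\<^sub>R \<xi> p = 0"
    using phi_phi[of p "\<phi> p x"] by simp
  moreover have "\<xi> p \<noteq> 0"
    using eta_xi[of p] eta_linear(5) by force
  ultimately show ?thesis by simp
qed

lemma g_xi [simp]: "g p x (\<xi> p) = \<eta> p x" "g p (\<xi> p) x = \<eta> p x"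
  using g_phi_phi[of p x "\<xi> p"] by (simp_all add: g_linear g_sym[of p "\<xi> p"])

text \<open>The B-metric condition at x and \<phi> y makes \<phi> self-adjoint; this is what makes
  the associated form symmetric.\<close>

lemma g_phi_left: "g p (\<phi> p x) y = g p x (\<phi> p y)"
  using g_phi_phi[of p x "\<phi> p y"] by (simp add: phi_phi g_linear)

lemma g_eqI: "(\<And>z. g p x z = g p y z) \<Longrightarrow> x = y"
  using g_nondegenerate[of p "x - y"] by (simp add: g_linear)

lemma vfield_near_xi: "vfield_near A p \<xi>"
  using xi_field by (auto simp: vfield_near_def)

lemma metric_compatible:
  "vfield_near A p Y \<Longrightarrow> vfield_near A p Z \<Longrightarrow>
    dir_deriv A p v (\<lambda>q. g q (Y q) (Z q)) = g p (nabla p v Y) (Z p) + g p (Y p) (nabla p v Z)"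
  using levi_civita by (simp add: levi_civita_def)

definition theta_xi :: "'m \<Rightarrow> real" where
  "theta_xi p = theta A \<phi> g nabla p (\<xi> p)"

text \<open>The F4 identity with its last argument removed by nondegeneracy; self-adjointness of
  \<phi> turns g(\<phi> x, \<phi> z) into g(\<phi>\<phi> x, z).\<close>

lemma nabla_phi:
  assumes "vfield_near A p Y"
  shows "nabla p x (\<lambda>q. \<phi> q (Y q)) - \<phi> p (nabla p x Y) =
    - (theta_xi p / 2) *\<^sub>R (g p (\<phi> p x) (\<phi> p (Y p)) *\<^sub>R \<xi> p + \<eta> p (Y p) *\<^sub>R \<phi> p (\<phi> p x))"
proof (rule g_eqI)
  fix z
  have "F_tensor \<phi> g nabla p x Y z = - (theta_xi p / 2) *
      (g p (\<phi> p x) (\<phi> p (Y p)) * \<eta> p z + g p (\<phi> p x) (\<phi> p z) * \<eta> p (Y p))"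
    using F4 assms unfolding F4_manifold_def theta_xi_def by blast
  then show "g p (nabla p x (\<lambda>q. \<phi> q (Y q)) - \<phi> p (nabla p x Y)) z = g p (- (theta_xi p / 2) *\<^sub>R
      (g p (\<phi> p x) (\<phi> p (Y p)) *\<^sub>R \<xi> p + \<eta> p (Y p) *\<^sub>R \<phi> p (\<phi> p x))) z"
    by (simp add: F_tensor_def g_linear g_phi_left[of p "\<phi> p x" z] algebra_simps)
qed

text \<open>At Y = \<xi> the first term of \<open>nabla_phi\<close> vanishes because \<phi>\<xi> =
  0, which determines \<phi> of the derivative. Since g(\<xi>, \<xi>) is constant, the derivative
  lies in the kernel of \<eta>, where a second application of \<phi> recovers it up to sign.\<close>

lemma nabla_xi: "nabla p x \<xi> = (theta_xi p / 2) *\<^sub>R \<phi> p x"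
proof -
  have "dir_deriv A p x (\<lambda>q. g q (\<xi> q) (\<xi> q)) = 0"
    by simp
  then have eta: "\<eta> p (nabla p x \<xi>) = 0"
    using metric_compatible[OF vfield_near_xi vfield_near_xi, of p x] by simp
  have "\<phi> p (nabla p x \<xi>) = (theta_xi p / 2) *\<^sub>R \<phi> p (\<phi> p x)"
    using nabla_phi[OF vfield_near_xi, of p x] by (simp add: nabla_zero[OF connection] g_linear)
  then have "\<phi> p (\<phi> p (nabla p x \<xi>)) = (theta_xi p / 2) *\<^sub>R \<phi> p (\<phi> p (\<phi> p x))"
    by (simp only: phi_linear)
  then have "- nabla p x \<xi> = - ((theta_xi p / 2) *\<^sub>R \<phi> p x)"
    using eta phi_phi[of p "nabla p x \<xi>"] phi_phi[of p "\<phi> p x"] by simp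
  then show ?thesis by simp
qed

section \<open>The associated metric and its Levi-Civita connection\<close>

abbreviation gt :: "'m \<Rightarrow> real^3 \<Rightarrow> real^3 \<Rightarrow> real" where
  "gt \<equiv> assoc_metric \<phi> \<eta> g"

lemma gt_sym: "gt p x y = gt p y x"
  unfolding assoc_metric_def using g_phi_left[of p x y] g_sym[of p "\<phi> p x" y] by simp

text \<open>Testing against \<xi> recovers \<eta>. The remaining part of the form recovers \<phi> of
  the vector, and the two together determine the vector.\<close>

lemma gt_eqI:
  assumes "\<And>z. gt p x z = gt p y z"
  shows "x = y"
proof -
  have eq: "g p x (\<phi> p z) + \<eta> p x * \<eta> p z = g p y (\<phi> p z) + \<eta> p y * \<eta> p z" for z
    using assms[of z] by (simp add: assoc_metric_def)
  have eta: "\<eta> p x = \<eta> p y"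
    using eq[of "\<xi> p"] by (simp add: g_linear)
  then have "\<phi> p x = \<phi> p y"
    using eq by (intro g_eqI[of p]) (simp add: g_phi_left)
  then have "\<phi> p (\<phi> p x) = \<phi> p (\<phi> p y)" by simp
  then show ?thesis
    using eta by (simp add: phi_phi)
qed

lemma gt_linear:
  "gt p (x + y) z = gt p x z + gt p y z" "gt p z (x + y) = gt p z x + gt p z y"
  "gt p (x - y) z = gt p x z - gt p y z" "gt p z (x - y) = gt p z x - gt p z y"
  "gt p (r *\<^sub>R x) z = r * gt p x z" "gt p z (r *\<^sub>R x) = r * gt p z x"
  "gt p (- x) z = - gt p x z" "gt p z (- x) = - gt p z x"
  by (simp_all add: assoc_metric_def g_linear phi_linear eta_linear algebra_simps)

text \<open>The associated metric is built from g, \<phi> and \<eta>, whose derivatives under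
  \<open>nabla\<close> are known; its own derivative comes out as S(x,y) \<eta>(z) + S(x,z)
  \<eta>(y). The difference \<open>D\<close> of the connections must compensate exactly this, and
  its symmetry leaves one solution.\<close>

lemma assoc_levi_civita_diff:
  assumes "levi_civita A gt nablat"
  shows "nablat p x (const_field p y) - nabla p x (const_field p y) =
    (theta_xi p / 2 * (g p x (\<phi> p y) - g p (\<phi> p x) (\<phi> p y))) *\<^sub>R \<xi> p"
proof -
  have conn': "affine_connection A nablat"
    using assms by (simp add: levi_civita_def)
  note cf = vfield_near_const_field[of p]
  define D where "D x y = nablat p x (const_field p y) - nabla p x (const_field p y)" for x y
  define S where "S x y = theta_xi p / 2 * (g p x (\<phi> p y) - g p (\<phi> p x) (\<phi> p y))" for x y
  have S_sym: "S x y = S y x" for x y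
    unfolding S_def
    by (metis g_phi_left g_sym)
  \<comment> \<open>Both connections are torsion-free, so the two skew parts are values of the same
    Lie bracket, and its uniqueness equates them.\<close>
  have D_sym: "D x y = D y x" for x y
  proof -
    have "is_lie_bracket A (const_field p x) (const_field p y) p
        (nablat p (const_field p x p) (const_field p y) - nablat p (const_field p y p) (const_field p x))"
      using assms cf unfolding levi_civita_def by blast
    moreover have "is_lie_bracket A (const_field p x) (const_field p y) p
        (nabla p (const_field p x p) (const_field p y) - nabla p (const_field p y p) (const_field p x))"
      using levi_civita cf unfolding levi_civita_def by blast
    ultimately have "nablat p x (const_field p y) - nablat p y (const_field p x) =
        nabla p x (const_field p y) - nabla p y (const_field p x)"
      using lie_bracket_unique by (metis const_field_at)
    then show ?thesis
      by (simp add: D_def algebra_simps)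
  qed
  have D_gt: "gt p (D x y) z + gt p y (D x z) = S x y * \<eta> p z + S x z * \<eta> p y" for x y z
  proof -
    let ?Y = "const_field p y" and ?Z = "const_field p z"
    note phiZ = vfield_near_tensor11[OF phi_tensor cf[of z]]
    have swap: "g p y (\<phi> p x) = g p x (\<phi> p y)" "g p z (\<phi> p x) = g p x (\<phi> p z)"
      "g p y (\<phi> p (\<phi> p x)) = g p (\<phi> p x) (\<phi> p y)"
      by (metis g_phi_left g_sym)+
    note diff = differentiable_tensor02[OF g_tensor]
    \<comment> \<open>Writing \<eta>(Y) as g(Y, \<xi>) reduces the derivative of the \<eta>-term to
      metric compatibility and \<open>nabla_xi\<close>. The simp rule \<open>g_xi\<close> is
      withheld below so that this form survives the product rule.\<close>
    have "dir_deriv A p x (\<lambda>q. gt q (?Y q) (?Z q)) =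
        dir_deriv A p x (\<lambda>q. g q (?Y q) (\<phi> q (?Z q)) + g q (?Y q) (\<xi> q) * g q (?Z q) (\<xi> q))"
      by (simp add: assoc_metric_def)
    also have "\<dots> = dir_deriv A p x (\<lambda>q. g q (?Y q) (\<phi> q (?Z q)))
        + dir_deriv A p x (\<lambda>q. g q (?Y q) (\<xi> q)) * \<eta> p z
        + \<eta> p y * dir_deriv A p x (\<lambda>q. g q (?Z q) (\<xi> q))"
      using diff[OF cf phiZ] diff[OF cf[of y] vfield_near_xi] diff[OF cf[of z] vfield_near_xi]
      by (simp add: differentiable_fun_at_add differentiable_fun_at_mult del: g_xi) simp
    also have "\<dots> = g p (nabla p x ?Y) (\<phi> p z) + g p y (nabla p x (\<lambda>q. \<phi> q (?Z q)))
        + (\<eta> p (nabla p x ?Y) + theta_xi p / 2 * g p y (\<phi> p x)) * \<eta> p z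
        + \<eta> p y * (\<eta> p (nabla p x ?Z) + theta_xi p / 2 * g p z (\<phi> p x))"
      using metric_compatible[OF cf[of y] phiZ] metric_compatible[OF cf vfield_near_xi, of x]
      by (simp add: nabla_xi g_linear)
    also have "nabla p x (\<lambda>q. \<phi> q (?Z q)) = \<phi> p (nabla p x ?Z)
        - (theta_xi p / 2) *\<^sub>R (g p (\<phi> p x) (\<phi> p z) *\<^sub>R \<xi> p + \<eta> p z *\<^sub>R \<phi> p (\<phi> p x))"
      using nabla_phi[OF cf[of z], of x] by (simp add: algebra_simps)
    finally have "dir_deriv A p x (\<lambda>q. gt q (?Y q) (?Z q)) =
        gt p (nabla p x ?Y) z + gt p y (nabla p x ?Z) + S x y * \<eta> p z + S x z * \<eta> p y"
      by (simp add: S_def assoc_metric_def g_linear swap algebra_simps)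
    moreover have "dir_deriv A p x (\<lambda>q. gt q (?Y q) (?Z q)) =
        gt p (nablat p x ?Y) z + gt p y (nablat p x ?Z)"
      using assms cf unfolding levi_civita_def by simp
    ultimately show ?thesis
      by (simp add: D_def gt_linear)
  qed
  \<comment> \<open>Koszul's permutation argument\<close>
  have "gt p (D x y) z = S x y * \<eta> p z" for z
    using D_gt[of x y z] D_gt[of y x z] D_gt[of z x y]
    unfolding D_sym[of y x] D_sym[of z x] D_sym[of z y] S_sym[of y x] S_sym[of z x] S_sym[of z y]
      gt_sym[of p y "D x z"] gt_sym[of p x "D y z"]
    by linarith
  then have "D x y = S x y *\<^sub>R \<xi> p"
    by (intro gt_eqI[of p]) (simp add: assoc_metric_def g_linear eta_linear g_phi_left)
  then show ?thesis
    by (simp add: D_def S_def)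
qed

text \<open>Otherwise \<phi> vanishes at \<open>p\<close> and every vector is a multiple of \<xi>,
  against dimension 3. It supplies a nonzero denominator when \<theta>(\<xi>) is read off from
  \<open>nabla_xi\<close>.\<close>

lemma exists_g_phi_nonzero: "\<exists>x y. g p (\<phi> p x) y \<noteq> 0"
proof (rule ccontr)
  assume "\<not> ?thesis"
  then have "\<phi> p x = 0" for x
    using g_nondegenerate[of p "\<phi> p x"] by blast
  then have "x = \<eta> p x *\<^sub>R \<xi> p" for x
    using phi_phi[of p x] by simp
  then have "x \<in> span {\<xi> p}" for x
    by (metis span_base span_scale singletonI)
  then have "(UNIV :: (real^3) set) = span {\<xi> p}" by blast
  then have "dim (UNIV :: (real^3) set) \<le> 1"
    by (metis card.empty card.insert dim_le_card dim_span empty_iff finite.emptyI finite_insert One_nat_def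
        span_superset)
  then show False by simp
qed

end

section \<open>Null curves with vanishing slant invariant\<close>

text \<open>The combination map is an injective linear endomorphism of \<open>real^3\<close>, hence
  surjective.\<close>

lemma spanning_triple:
  fixes x y z :: "real^3"
  assumes "\<And>\<alpha> \<beta> \<delta>. \<alpha> *\<^sub>R x + \<beta> *\<^sub>R y + \<delta> *\<^sub>R z = 0 \<Longrightarrow> \<alpha> = 0 \<and> \<beta> = 0 \<and> \<delta> = 0"
  obtains \<alpha> \<beta> \<delta> where "u = \<alpha> *\<^sub>R x + \<beta> *\<^sub>R y + \<delta> *\<^sub>R z"
proof -
  define f where "f c = (c $ 1) *\<^sub>R x + (c $ 2) *\<^sub>R y + (c $ 3) *\<^sub>R z" for c :: "real^3"
  have lin: "linear f"
    by (rule linearI) (simp_all add: f_def algebra_simps)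
  have "c = 0" if "f c = 0" for c
    using assms[of "c $ 1" "c $ 2" "c $ 3"] that by (simp add: f_def vec_eq_iff forall_3)
  then have "inj f"
    using linear_injective_0[OF lin] by blast
  then have "surj f"
    using lin linear_injective_imp_surjective by blast
  then obtain c where "f c = u"
    by (metis surjD)
  then show ?thesis
    using that by (auto simp: f_def)
qed

locale null_slant_curve = F4_manifold3 A \<phi> \<xi> \<eta> g nabla + smooth_curve3 A C I
  for A :: "'m::{t2_space,second_countable_topology} chart set"
    and \<phi> :: "'m \<Rightarrow> real^3 \<Rightarrow> real^3" and \<xi> :: "'m \<Rightarrow> real^3"
    and \<eta> :: "'m \<Rightarrow> real^3 \<Rightarrow> real" and g :: "'m \<Rightarrow> real^3 \<Rightarrow> real^3 \<Rightarrow> real"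
    and nabla :: "'m connection" and C :: "real \<Rightarrow> 'm" and I :: "real set" +
  fixes a :: real and nablat :: "'m connection"
  assumes null: "null_curve A g C I"
    and slant: "phi_slant_with A \<phi> \<xi> \<eta> g C I a 0"
    and levi_civita_assoc: "levi_civita A gt nablat"
begin

abbreviation phi_vel :: "real \<Rightarrow> real^3" where
  "phi_vel t \<equiv> \<phi> (C t) (vel t)"

lemma eta_vel: "t \<in> I \<Longrightarrow> \<eta> (C t) (vel t) = a"
  using slant by (simp add: phi_slant_with_def)

lemma g_vel:
  assumes "t \<in> I"
  shows "g (C t) (vel t) (vel t) = 0" "g (C t) (vel t) (phi_vel t) = 0"
    "g (C t) (phi_vel t) (vel t) = 0" "g (C t) (phi_vel t) (phi_vel t) = a\<^sup>2"
  using null slant assms g_phi_phi[of "C t" "vel t" "vel t"] g_phi_left[of "C t" "vel t" "vel t"]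
  by (simp_all add: null_curve_def phi_slant_with_def power2_eq_square)

text \<open>Applying \<phi> to a linear relation kills its \<xi>-term. On the image of \<phi> the
  square of \<phi> is minus the identity, so \<alpha> + \<delta> \<phi> acts there like a complex
  number, and it annihilates \<phi> v only when \<alpha>^2 + \<delta>^2 = 0.\<close>

lemma vel_frame:
  assumes t: "t \<in> I"
  obtains \<alpha> \<beta> \<delta> where "u = \<alpha> *\<^sub>R vel t + \<beta> *\<^sub>R \<xi> (C t) + \<delta> *\<^sub>R phi_vel t"
proof (rule spanning_triple)
  let ?p = "C t"
  fix \<alpha> \<beta> \<delta> :: real
  assume eq: "\<alpha> *\<^sub>R vel t + \<beta> *\<^sub>R \<xi> ?p + \<delta> *\<^sub>R phi_vel t = 0"
  have phi3: "\<phi> ?p (\<phi> ?p (phi_vel t)) = - phi_vel t"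
    using phi_phi[of ?p "phi_vel t"] by simp
  \<comment> \<open>If \<phi> v = 0 then v = a \<xi>, of square a^2; nullness forces a = 0 and hence
    v = 0.\<close>
  have "phi_vel t \<noteq> 0"
  proof
    assume "phi_vel t = 0"
    then have "vel t = a *\<^sub>R \<xi> ?p"
      using phi_phi[of ?p "vel t"] by (simp add: phi_linear eta_vel[OF t])
    moreover from this have "a = 0"
      using g_vel(1)[OF t] by (simp add: g_linear eta_linear)
    ultimately show False
      using null t by (simp add: null_curve_def)
  qed
  moreover have 1: "\<alpha> *\<^sub>R phi_vel t + \<delta> *\<^sub>R \<phi> ?p (phi_vel t) = 0"
    using arg_cong[OF eq, of "\<phi> ?p"] by (simp add: phi_linear)
  have 2: "\<alpha> *\<^sub>R \<phi> ?p (phi_vel t) - \<delta> *\<^sub>R phi_vel t = 0"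
    using arg_cong[OF 1, of "\<phi> ?p"] by (simp add: phi_linear phi3)
  have "(\<alpha>\<^sup>2 + \<delta>\<^sup>2) *\<^sub>R phi_vel t = \<alpha> *\<^sub>R (\<alpha> *\<^sub>R phi_vel t + \<delta> *\<^sub>R \<phi> ?p (phi_vel t))
      - \<delta> *\<^sub>R (\<alpha> *\<^sub>R \<phi> ?p (phi_vel t) - \<delta> *\<^sub>R phi_vel t)"
    by (simp add: algebra_simps power2_eq_square)
  then have "(\<alpha>\<^sup>2 + \<delta>\<^sup>2) *\<^sub>R phi_vel t = 0"
    using 1 2 by simp
  ultimately have "\<alpha> = 0 \<and> \<delta> = 0"
    by (simp add: sum_power2_eq_zero_iff)
  moreover from this have "\<beta> = 0"
    using arg_cong[OF eq, of "\<eta> ?p"] by (simp add: eta_linear)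
  ultimately show "\<alpha> = 0 \<and> \<beta> = 0 \<and> \<delta> = 0" by simp
qed

text \<open>For a = 0 the velocity would be orthogonal to v, \<xi> and \<phi> v, hence to
  everything.\<close>

lemma slant_nonzero: "a \<noteq> 0"
proof
  assume a: "a = 0"
  obtain t where t: "t \<in> I"
    using interval_nonempty by blast
  have "g (C t) (vel t) u = 0" for u
    by (rule vel_frame[OF t, of u]) (use g_vel[OF t] eta_vel[OF t] a in \<open>simp add: g_linear\<close>)
  then have "vel t = 0"
    by (rule g_nondegenerate)
  then show False
    using null t by (simp add: null_curve_def)
qed

section \<open>Covariant derivatives of \<open>vel\<close>, \<open>\<xi>\<close> and
  \<open>phi_vel\<close> along the curve\<close>

lemma vfield_along_xi: "vfield_along A C I (\<lambda>s. \<xi> (C s))"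
  by (rule vfield_along_field[OF xi_field])

lemma vfield_along_phi_vel: "vfield_along A C I phi_vel"
  by (rule vfield_along_tensor11[OF phi_tensor vfield_along_velocity])

lemma metric_along_constant:
  assumes "t \<in> I" "vfield_along A C I V" "vfield_along A C I W"
    and const: "\<And>s. s \<in> I \<Longrightarrow> g (C s) (V s) (W s) = r"
  shows "g (C t) (cov_deriv_along A nabla C V t) (W t)
    + g (C t) (V t) (cov_deriv_along A nabla C W t) = 0"
proof -
  have "((\<lambda>s. r) has_real_derivative g (C t) (cov_deriv_along A nabla C V t) (W t)
      + g (C t) (V t) (cov_deriv_along A nabla C W t)) (at t)"
    by (rule has_field_derivative_transform_within_open
        [OF DERIV_metric_along[OF levi_civita g_tensor assms(1-3)] open_interval assms(1)])
       (rule const)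
  then show ?thesis
    using DERIV_unique DERIV_const by blast
qed

lemma cov_deriv_xi:
  "t \<in> I \<Longrightarrow> cov_deriv_along A nabla C (\<lambda>s. \<xi> (C s)) t = (theta_xi (C t) / 2) *\<^sub>R phi_vel t"
  by (simp add: cov_deriv_along_field[OF connection _ vfield_near_xi] nabla_xi)

lemma cov_deriv_phi_vel_eq:
  "t \<in> I \<Longrightarrow> cov_deriv_along A nabla C phi_vel t = \<phi> (C t) (cov_deriv_along A nabla C vel t)
    - (theta_xi (C t) / 2) *\<^sub>R (a\<^sup>2 *\<^sub>R \<xi> (C t) + a *\<^sub>R \<phi> (C t) (phi_vel t))"
  by (simp add: cov_deriv_along_tensor11[OF connection phi_tensor vfield_along_velocity]
      nabla_phi[OF vfield_near_const_field] g_vel eta_vel)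

lemma cov_deriv_vel:
  assumes t: "t \<in> I"
  shows "cov_deriv_along A nabla C vel t = (theta_xi (C t) * a / 2) *\<^sub>R phi_vel t"
proof (rule g_eqI)
  fix z
  let ?p = "C t" and ?D = "cov_deriv_along A nabla C vel t"
  have 1: "g ?p ?D (vel t) = 0"
    using metric_along_constant[OF t vfield_along_velocity vfield_along_velocity g_vel(1)]
      g_sym[of ?p ?D "vel t"] by simp
  have 2: "\<eta> ?p ?D = 0"
    using metric_along_constant[OF t vfield_along_velocity vfield_along_xi, of a] eta_vel t
    by (simp add: cov_deriv_xi g_linear g_vel)
  \<comment> \<open>Self-adjointness gives g(v, \<phi> D) = g(\<phi> v, D), so the unknown appears
    twice. The two terms of the F4 correction contribute a^3 each, and the factor 2 cancels.\<close>
  have "g ?p ?D (phi_vel t) + g ?p (vel t) (cov_deriv_along A nabla C phi_vel t) = 0"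
    by (rule metric_along_constant[OF t vfield_along_velocity vfield_along_phi_vel g_vel(2)])
  then have 3: "g ?p ?D (phi_vel t) = theta_xi ?p * a / 2 * a\<^sup>2"
    using t g_phi_left[of ?p "vel t" ?D] g_phi_left[of ?p "vel t" "phi_vel t"] g_sym[of ?p ?D "phi_vel t"]
    by (simp add: cov_deriv_phi_vel_eq g_linear g_vel eta_vel algebra_simps)
  obtain \<alpha> \<beta> \<delta> where "z = \<alpha> *\<^sub>R vel t + \<beta> *\<^sub>R \<xi> ?p + \<delta> *\<^sub>R phi_vel t"
    by (rule vel_frame[OF t])
  then show "g ?p ?D z = g ?p ((theta_xi ?p * a / 2) *\<^sub>R phi_vel t) z"
    using t by (simp add: g_linear g_vel eta_linear 1 2 3)
qed

lemma frame_W1_eq: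
  "frame_W1 A \<phi> \<xi> C a 0 t = (1 / a) *\<^sub>R phi_vel t"
proof -
  have "sqrt (a ^ 4) = a\<^sup>2"
    by (rule real_sqrt_unique) simp_all
  then show ?thesis
    using slant_nonzero by (simp add: frame_W1_def power2_eq_square)
qed

lemma frame_N1_eq: "frame_N1 A \<phi> \<xi> C a 0 t = (1 / a) *\<^sub>R \<xi> (C t) - (1 / (2 * a\<^sup>2)) *\<^sub>R vel t"
  using slant_nonzero by (simp add: frame_N1_def power_numeral_reduce)

text \<open>The description by \<open>THE\<close> is legitimate because \<phi> v has square a^2,
  which is nonzero, so \<open>frame_W1\<close> does not vanish.\<close>

lemma curvature_k1_eq:
  assumes t: "t \<in> I"
  shows "curvature_k1 A \<phi> \<xi> nabla C a 0 t = theta_xi (C t) * a\<^sup>2 / 2"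
proof -
  have "phi_vel t \<noteq> 0"
    using g_vel(4)[OF t] slant_nonzero by (auto simp: g_linear)
  then have iff: "cov_deriv_along A nabla C vel t = k *\<^sub>R frame_W1 A \<phi> \<xi> C a 0 t \<longleftrightarrow>
      k = theta_xi (C t) * a\<^sup>2 / 2" for k
    using slant_nonzero t
    by (auto simp: cov_deriv_vel frame_W1_eq power2_eq_square field_simps)
  show ?thesis
    by (simp only: curvature_k1_def iff the_eq_trivial)
qed

lemma cov_deriv_assoc:
  "cov_deriv_along A nablat C V t = cov_deriv_along A nabla C V t + (theta_xi (C t) / 2 *
    (g (C t) (vel t) (\<phi> (C t) (V t)) - g (C t) (phi_vel t) (\<phi> (C t) (V t)))) *\<^sub>R \<xi> (C t)"
  using cov_deriv_along_diff_connection[OF connection, of nablat V t] levi_civita_assoc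
    assoc_levi_civita_diff[OF levi_civita_assoc, of "C t" "vel t" "V t"]
  by (simp add: levi_civita_def)

lemma cov_deriv_assoc_vel:
  "t \<in> I \<Longrightarrow> cov_deriv_along A nablat C vel t =
    (theta_xi (C t) * a\<^sup>2 / 2) *\<^sub>R ((1 / a) *\<^sub>R phi_vel t - \<xi> (C t))"
  using slant_nonzero
  by (simp add: cov_deriv_assoc cov_deriv_vel g_vel algebra_simps power2_eq_square)

lemma cov_deriv_assoc_xi:
  "t \<in> I \<Longrightarrow> cov_deriv_along A nablat C (\<lambda>s. \<xi> (C s)) t = (theta_xi (C t) / 2) *\<^sub>R phi_vel t"
  by (simp add: cov_deriv_assoc cov_deriv_xi g_linear)

text \<open>For \<open>nabla\<close> the derivative is -(\<theta>(\<xi>) a^2 / 2) \<xi>, and the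
  difference of the connections adds the opposite. This cancellation is the source of equal
  curvature and torsion: \<phi> v - v and -v have the same derivative.\<close>

lemma cov_deriv_assoc_phi_vel: "t \<in> I \<Longrightarrow> cov_deriv_along A nablat C phi_vel t = 0"
proof -
  assume t: "t \<in> I"
  have phi2: "\<phi> (C t) (phi_vel t) = - vel t + a *\<^sub>R \<xi> (C t)"
    by (simp add: phi_phi eta_vel t)
  show ?thesis
    by (simp add: phi2 cov_deriv_assoc cov_deriv_phi_vel_eq cov_deriv_vel phi_linear g_linear g_vel
        eta_vel t algebra_simps power2_eq_square)
qed

lemma gt_vel:
  assumes t: "t \<in> I"
  shows "gt (C t) (vel t) (vel t) = a\<^sup>2" "gt (C t) (vel t) (\<xi> (C t)) = a"
    "gt (C t) (vel t) (phi_vel t) = a\<^sup>2" "gt (C t) (\<xi> (C t)) (\<xi> (C t)) = 1"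
    "gt (C t) (\<xi> (C t)) (phi_vel t) = 0" "gt (C t) (phi_vel t) (phi_vel t) = 0"
    "gt (C t) (\<xi> (C t)) (vel t) = a"
    "gt (C t) (phi_vel t) (vel t) = a\<^sup>2" "gt (C t) (phi_vel t) (\<xi> (C t)) = 0"
  using t by (simp_all add: assoc_metric_def phi_phi eta_vel g_vel g_linear power2_eq_square)

text \<open>With fields X and Y fixed near \<open>C t\<close>, \<open>nabla_xi\<close> gives
  \<theta>(\<xi>) = 2 g(\<nabla>_X \<xi>, Y) / g(\<phi> X, Y), where X and Y are chosen with nonzero
  denominator at \<open>C t\<close>. The numerator is differentiable because a connection maps
  smooth fields to smooth fields.\<close>

lemma continuous_theta_xi: "continuous_on I (\<lambda>t. theta_xi (C t))"
proof (rule continuous_at_imp_continuous_on, rule ballI)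
  fix t assume t: "t \<in> I"
  let ?p = "C t"
  obtain x y where xy: "g ?p (\<phi> ?p x) y \<noteq> 0"
    using exists_g_phi_nonzero by blast
  let ?X = "const_field ?p x" and ?Y = "const_field ?p y"
  define h where "h q = g q (\<phi> q (?X q)) (?Y q)" for q
  define k where "k q = g q (nabla q (?X q) \<xi>) (?Y q)" for q
  have nabla: "vfield_near A ?p (\<lambda>q. nabla q (?X q) \<xi>)"
    using connection vfield_on_const_field[of ?p x] vfield_on_subset[OF xi_field]
    unfolding affine_connection_def vfield_near_def
    by (meson chart_at_atlas chart_at_mem open_chart subset_UNIV)
  have "isCont (\<lambda>s. h (C s)) t" "isCont (\<lambda>s. k (C s)) t"
    unfolding h_def k_def
    by (rule DERIV_isCont[OF DERIV_along[OF t differentiable_tensor02[OF g_tensor]]],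
        (intro vfield_near_tensor11[OF phi_tensor] vfield_near_const_field nabla)+)+
  moreover have "h (C t) \<noteq> 0"
    using xy by (simp add: h_def)
  ultimately have cont: "isCont (\<lambda>s. 2 * k (C s) / h (C s)) t"
    and "\<forall>\<^sub>F s in nhds t. h (C s) \<noteq> 0"
    using tendsto_imp_eventually_ne[of "\<lambda>s. h (C s)" "h (C t)" "nhds t" 0]
      tendsto_at_iff_tendsto_nhds[of "\<lambda>s. h (C s)" t]
    by (intro continuous_intros, auto simp: isCont_def)
  then have "\<forall>\<^sub>F s in nhds t. theta_xi (C s) = 2 * k (C s) / h (C s)"
    by (auto elim!: eventually_mono simp: h_def k_def nabla_xi g_linear)
  then show "isCont (\<lambda>t. theta_xi (C t)) t"
    using cont isCont_cong[of "\<lambda>s. theta_xi (C s)" "\<lambda>s. 2 * k (C s) / h (C s)" t] by simp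
qed

text \<open>Intermediate value theorem: the image of the interval is an interval that misses
  0.\<close>

lemma sgn_theta_xi_constant:
  assumes "\<And>t. t \<in> I \<Longrightarrow> theta_xi (C t) \<noteq> 0" "s \<in> I" "t \<in> I"
  shows "sgn (theta_xi (C s)) = sgn (theta_xi (C t))"
proof -
  let ?S = "(\<lambda>t. theta_xi (C t)) ` I"
  have "connected ?S"
    using is_interval continuous_theta_xi
    by (intro connected_continuous_image) (simp_all add: is_interval_connected)
  then have "is_interval ?S"
    by (simp add: is_interval_connected_1)
  moreover have "0 \<notin> ?S"
    using assms(1) by auto
  moreover have "theta_xi (C s) \<in> ?S" "theta_xi (C t) \<in> ?S"
    using assms by auto
  ultimately have "\<not> (theta_xi (C s) < 0 \<and> 0 < theta_xi (C t))" "\<not> (theta_xi (C t) < 0 \<and> 0 < theta_xi (C s))"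
    by (meson is_interval_1 less_imp_le)+
  then show ?thesis
    using assms by (auto simp: sgn_real_def not_less)
qed

end

text \<open>Parameterized by arc length of the associated metric, a curve as above has slant constant
  \<open>a = \<plusminus>1\<close>.\<close>

locale unit_null_slant_curve = null_slant_curve +
  assumes unit: "\<bar>a\<bar> = 1"
begin

lemma unit_simps: "a\<^sup>2 = 1" "a * a = 1" "1 / a = a" "a * (a * x) = x" for x :: real
proof -
  have "a = 1 \<or> a = -1" using unit by linarith
  then show "a\<^sup>2 = 1" "a * a = 1" "1 / a = a" "a * (a * x) = x" by auto
qed

text \<open>The candidate for \<open>E2\<close>, with \<open>a\<close> in place of 1/a because
  \<open>a\<close> is 1 or -1 here; \<open>e\<close> stands for the sign of \<theta>(\<xi>).
  Differences are written with the factor -1 to match the closure rules for sums and scalar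
  multiples, here and in \<open>binormal\<close>.\<close>

definition normal :: "real \<Rightarrow> real \<Rightarrow> real^3" where
  "normal e s = e *\<^sub>R (a *\<^sub>R phi_vel s + (-1) *\<^sub>R \<xi> (C s))"

definition binormal :: "real \<Rightarrow> real^3" where
  "binormal s = phi_vel s + (-1) *\<^sub>R vel s"

lemma vfield_along_normal: "vfield_along A C I (normal e)"
  unfolding normal_def[abs_def]
  by (intro vfield_along_scaleR vfield_along_add vfield_along_phi_vel vfield_along_xi)

lemma vfield_along_binormal: "vfield_along A C I binormal"
  unfolding binormal_def[abs_def]
  by (intro vfield_along_scaleR vfield_along_add vfield_along_phi_vel vfield_along_velocity)

lemma cov_deriv_normal:
  assumes "t \<in> I"
  shows "cov_deriv_along A nablat C (normal e) t = - (e * theta_xi (C t) / 2) *\<^sub>R phi_vel t"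
  unfolding normal_def[abs_def]
  by (simp only: cov_deriv_along_scaleR cov_deriv_along_add vfield_along_scaleR vfield_along_add
      vfield_along_phi_vel vfield_along_xi assms cov_deriv_assoc_xi cov_deriv_assoc_phi_vel) simp

lemma cov_deriv_binormal:
  assumes "t \<in> I"
  shows "cov_deriv_along A nablat C binormal t =
    - (theta_xi (C t) / 2) *\<^sub>R (a *\<^sub>R phi_vel t - \<xi> (C t))"
  unfolding binormal_def[abs_def]
  by (simp only: cov_deriv_along_scaleR cov_deriv_along_add vfield_along_scaleR vfield_along_add
      vfield_along_phi_vel vfield_along_velocity assms cov_deriv_assoc_vel cov_deriv_assoc_phi_vel)
     (simp add: unit_simps)

lemma frame_orthonormal:
  assumes "t \<in> I"
  shows "gt (C t) (vel t) (vel t) = 1" "e * e = 1 \<Longrightarrow> gt (C t) (normal e t) (normal e t) = 1"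
    "gt (C t) (binormal t) (binormal t) = -1"
    "gt (C t) (vel t) (normal e t) = 0" "gt (C t) (vel t) (binormal t) = 0"
    "gt (C t) (normal e t) (binormal t) = 0"
  using assms by (simp_all add: normal_def binormal_def gt_linear gt_vel unit_simps)

text \<open>Curvature and torsion must be positive, so \<theta>(\<xi>) is split into its absolute
  value and its sign \<open>e\<close>, and the sign is absorbed into \<open>normal\<close>.\<close>

lemma frenet_apparatus_exists:
  assumes e: "\<And>t. t \<in> I \<Longrightarrow> theta_xi (C t) \<noteq> 0 \<and> sgn (theta_xi (C t)) = e"
  shows "frenet_apparatus A gt nablat C I 1 1 (-1) vel (normal e) binormal
    (\<lambda>s. \<bar>theta_xi (C s)\<bar> / 2) (\<lambda>s. \<bar>theta_xi (C s)\<bar> / 2)"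
proof -
  have ee: "e * e = 1" "theta_xi (C t) = \<bar>theta_xi (C t)\<bar> * e" "e * theta_xi (C t) = \<bar>theta_xi (C t)\<bar>"
    if "t \<in> I" for t
    using e[OF that] by (auto simp: sgn_real_def split: if_splits)
  have "cov_deriv_along A nablat C vel t = (1 * (\<bar>theta_xi (C t)\<bar> / 2)) *\<^sub>R normal e t" if t: "t \<in> I" for t
  proof -
    have "cov_deriv_along A nablat C vel t = (theta_xi (C t) / 2) *\<^sub>R (a *\<^sub>R phi_vel t - \<xi> (C t))"
      using t by (simp add: cov_deriv_assoc_vel unit_simps)
    also have "\<dots> = (\<bar>theta_xi (C t)\<bar> / 2) *\<^sub>R normal e t"
      by (subst ee(2)[OF t]) (simp add: normal_def)
    finally show ?thesis by simp
  qed
  \<comment> \<open>The derivative is a multiple of \<open>phi_vel\<close>, which is the sum of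
    \<open>vel\<close> and \<open>binormal\<close>; hence both Frenet coefficients are the
    same.\<close>
  moreover have "cov_deriv_along A nablat C (normal e) t =
      - (1 * (\<bar>theta_xi (C t)\<bar> / 2)) *\<^sub>R vel t + (-1 * (\<bar>theta_xi (C t)\<bar> / 2)) *\<^sub>R binormal t" if t: "t \<in> I" for t
    using t ee(3)[OF t] by (simp add: cov_deriv_normal binormal_def algebra_simps)
  moreover have "cov_deriv_along A nablat C binormal t = - (1 * (\<bar>theta_xi (C t)\<bar> / 2)) *\<^sub>R normal e t"
    if t: "t \<in> I" for t
  proof -
    have "cov_deriv_along A nablat C binormal t = - (theta_xi (C t) / 2) *\<^sub>R (a *\<^sub>R phi_vel t - \<xi> (C t))"
      using t by (simp add: cov_deriv_binormal)
    also have "\<dots> = - (\<bar>theta_xi (C t)\<bar> / 2) *\<^sub>R normal e t"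
      by (subst ee(2)[OF t]) (simp add: normal_def)
    finally show ?thesis by simp
  qed
  ultimately show ?thesis
    unfolding frenet_apparatus_def unit_speed_def
    using curve vfield_along_velocity vfield_along_normal vfield_along_binormal ee(1) e
    by (simp add: frame_orthonormal)
qed

text \<open>The velocity fixes \<open>E1\<close>. Its derivative then fixes \<open>k\<close>,
  \<open>E2\<close> and \<epsilon>2, and the derivative of \<open>E2\<close> fixes \<tau> and
  \<open>E3\<close>. The canonical apparatus supplies the other side of each comparison.\<close>

lemma frenet_apparatus_unique:
  assumes e: "\<And>t. t \<in> I \<Longrightarrow> theta_xi (C t) \<noteq> 0 \<and> sgn (theta_xi (C t)) = e"
    and fr: "frenet_apparatus A gt nablat C I \<epsilon>1 \<epsilon>2 \<epsilon>3 E1 E2 E3 k \<tau>"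
  shows "\<epsilon>1 = 1 \<and> \<epsilon>2 = 1 \<and> \<epsilon>3 = -1 \<and> (\<forall>t\<in>I. E1 t = vel t \<and> E2 t = normal e t \<and> E3 t = binormal t \<and>
    k t = \<bar>theta_xi (C t)\<bar> / 2 \<and> \<tau> t = k t)"
proof -
  note ex = frenet_apparatus_exists[OF e, unfolded frenet_apparatus_def]
  note fr = fr[unfolded frenet_apparatus_def]
  \<comment> \<open>Comparing squares gives
    \<open>r\<^sup>2 * \<delta> = r'\<^sup>2 * \<delta>'\<close>. Opposite signs would make a sum of
    two positive numbers vanish; equal signs and positivity then give \<open>r = r'\<close>.\<close>
  have scaling: "r = r' \<and> x = x' \<and> \<delta> = \<delta>'"
    if "r *\<^sub>R x = r' *\<^sub>R x'" "r > 0" "r' > 0" "gt p x x = \<delta>" "gt p x' x' = \<delta>'"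
      "\<delta> \<in> {1, -1}" "\<delta>' \<in> {1, -1}" for r r' \<delta> \<delta>' :: real and x x' p
  proof -
    have "gt p (r *\<^sub>R x) (r *\<^sub>R x) = gt p (r' *\<^sub>R x') (r' *\<^sub>R x')"
      using that(1) by simp
    then have sq: "r\<^sup>2 * \<delta> = r'\<^sup>2 * \<delta>'"
      using that(4,5) by (simp add: gt_linear power2_eq_square mult.assoc)
    have pos: "r\<^sup>2 > 0" "r'\<^sup>2 > 0"
      using that by auto
    have "\<delta> = \<delta>'"
    proof (rule ccontr)
      assume "\<delta> \<noteq> \<delta>'"
      then have "\<delta>' = - \<delta>" "\<delta> \<noteq> 0"
        using that(6,7) by auto
      then have "(r\<^sup>2 + r'\<^sup>2) * \<delta> = 0"
        using sq by (simp add: algebra_simps)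
      then show False
        using pos \<open>\<delta> \<noteq> 0\<close> by (simp add: sum_power2_eq_zero_iff)
    qed
    then have "r\<^sup>2 = r'\<^sup>2"
      using sq that(7) by auto
    then have "r = r'"
      using that by (simp add: power2_eq_iff_nonneg)
    then show ?thesis
      using that \<open>\<delta> = \<delta>'\<close> by simp
  qed
  have step: "\<epsilon>1 = 1 \<and> E1 t = vel t \<and> \<epsilon>2 = 1 \<and> E2 t = normal e t \<and> k t = \<bar>theta_xi (C t)\<bar> / 2"
    if t: "t \<in> I" for t
  proof -
    have E1: "E1 s = vel s" if "s \<in> I" for s
      using fr that by blast
    have 1: "\<epsilon>1 = 1"
      using fr ex t E1[OF t] by metis
    have "cov_deriv_along A nablat C E1 t = cov_deriv_along A nablat C vel t"
      by (rule cov_deriv_along_cong[OF t E1])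
    then have eq: "(\<epsilon>2 * k t) *\<^sub>R E2 t = (\<bar>theta_xi (C t)\<bar> / 2) *\<^sub>R normal e t"
      using fr ex t by simp
    have k: "k t > 0" "gt (C t) (E2 t) (E2 t) = \<epsilon>2" "\<epsilon>2 \<in> {1,-1}"
      using fr t by blast+
    \<comment> \<open>The sign \<epsilon>2 moves onto the vector to leave a positive scalar; the
      vector \<open>\<epsilon>2 *\<^sub>R E2 t\<close> still has square \<epsilon>2.\<close>
    have "k t *\<^sub>R (\<epsilon>2 *\<^sub>R E2 t) = (\<bar>theta_xi (C t)\<bar> / 2) *\<^sub>R normal e t"
      using eq by (simp add: mult.commute)
    then have "k t = \<bar>theta_xi (C t)\<bar> / 2 \<and> \<epsilon>2 *\<^sub>R E2 t = normal e t \<and> \<epsilon>2 = 1"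
      by (rule scaling[of _ _ _ _ "C t"]) (use k ex e t in \<open>auto simp: gt_linear\<close>)
    then show ?thesis
      using 1 E1[OF t] by auto
  qed
  obtain t0 where "t0 \<in> I"
    using interval_nonempty by blast
  then have signs: "\<epsilon>1 = 1" "\<epsilon>2 = 1" "\<epsilon>3 = -1"
    using step[of t0] fr by auto
  moreover have "E3 t = binormal t \<and> \<tau> t = k t" if t: "t \<in> I" for t
  proof -
    have "cov_deriv_along A nablat C E2 t = cov_deriv_along A nablat C (normal e) t"
      by (rule cov_deriv_along_cong[OF t]) (use step in blast)
    then have "- (\<epsilon>1 * k t) *\<^sub>R E1 t + (\<epsilon>3 * \<tau> t) *\<^sub>R E3 t = - (1 * (\<bar>theta_xi (C t)\<bar> / 2)) *\<^sub>R vel t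
        + (-1 * (\<bar>theta_xi (C t)\<bar> / 2)) *\<^sub>R binormal t"
      using fr ex t by metis
    \<comment> \<open>The terms along the velocity agree and cancel. Both \<open>E3 t\<close> and
      \<open>binormal t\<close> have square -1, which is the trivial third conjunct of the next
      fact.\<close>
    then have "\<tau> t *\<^sub>R E3 t = k t *\<^sub>R binormal t"
      using step[OF t] signs by simp
    then have "\<tau> t = k t \<and> E3 t = binormal t \<and> (-1::real) = -1"
      by (rule scaling[of _ _ _ _ "C t"]) (use fr ex t signs in auto)
    then show ?thesis by simp
  qed
  ultimately show ?thesis
    using step by blast
qed

end

section \<open>Passage to arc length and back to the original parameter\<close>

theorem theorem4p2:
  fixes A :: "'m::{t2_space,second_countable_topology} chart set"
    and \<phi> :: "'m \<Rightarrow> real^3 \<Rightarrow> real^3" and \<xi> :: "'m \<Rightarrow> real^3"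
    and \<eta> :: "'m \<Rightarrow> real^3 \<Rightarrow> real" and g gt :: "'m \<Rightarrow> real^3 \<Rightarrow> real^3 \<Rightarrow> real"
    and nabla nablat :: "'m connection"
    and C \<gamma> :: "real \<Rightarrow> 'm" and I J :: "real set" and a b :: real
    and vel N1 W1 :: "real \<Rightarrow> real^3" and k1 \<theta>\<xi> \<sigma> :: "real \<Rightarrow> real"
  assumes F4: "F4_manifold A \<phi> \<xi> \<eta> g nabla"
    and gt: "gt = assoc_metric \<phi> \<eta> g"
    and nablat: "levi_civita A gt nablat"
    and C: "smooth_curve A C I" and null: "null_curve A g C I"
    and slant: "phi_slant_with A \<phi> \<xi> \<eta> g C I a b" and b: "b = 0"
    and vel: "vel = velocity A C"
    and N1: "N1 = frame_N1 A \<phi> \<xi> C a b" and W1: "W1 = frame_W1 A \<phi> \<xi> C a b"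
    and k1: "k1 = curvature_k1 A \<phi> \<xi> nabla C a b"
    and \<theta>\<xi>: "\<theta>\<xi> = (\<lambda>t. theta A \<phi> g nabla (C t) (\<xi> (C t)))"
    and arc: "arc_length_parameter A gt C I \<sigma>"
    and \<gamma>: "\<gamma> = C \<circ> inv_into I \<sigma>" and J: "J = \<sigma> ` I"
  shows "smooth_curve A \<gamma> J \<and> unit_speed A gt \<gamma> J 1 \<and> phi_slant A \<phi> \<xi> \<eta> gt \<gamma> J \<and>
    ((\<forall>t\<in>I. k1 t \<noteq> 0) \<longrightarrow>
       frenet_curve3 A gt nablat \<gamma> J \<and>
       (\<exists>\<epsilon>t. (\<forall>t\<in>I. \<epsilon>t = sgn (k1 t) \<and> \<epsilon>t = sgn (\<theta>\<xi> t)) \<and>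
         (\<forall>\<epsilon>1 \<epsilon>2 \<epsilon>3 E1 E2 E3 k \<tau>.
            frenet_apparatus A gt nablat \<gamma> J \<epsilon>1 \<epsilon>2 \<epsilon>3 E1 E2 E3 k \<tau> \<longrightarrow>
            \<epsilon>1 = 1 \<and> \<epsilon>2 = 1 \<and> \<epsilon>3 = -1 \<and>
            (\<forall>t\<in>I.
               E1 (\<sigma> t) = velocity A \<gamma> (\<sigma> t) \<and>
               E1 (\<sigma> t) = (1 / \<bar>a\<bar>) *\<^sub>R vel t \<and>
               E2 (\<sigma> t) = \<epsilon>t *\<^sub>R ((1 / a) *\<^sub>R \<phi> (C t) (vel t) - \<xi> (C t)) \<and>
               E2 (\<sigma> t) = \<epsilon>t *\<^sub>R (- (1 / (2 * a)) *\<^sub>R vel t - a *\<^sub>R N1 t + W1 t) \<and>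
               E3 (\<sigma> t) = (1 / \<bar>a\<bar>) *\<^sub>R (\<phi> (C t) (vel t) - vel t) \<and>
               E3 (\<sigma> t) = sgn a *\<^sub>R (- (1 / a) *\<^sub>R vel t + W1 t) \<and>
               k (\<sigma> t) = \<bar>k1 t\<bar> / a\<^sup>2 \<and>
               k (\<sigma> t) = \<bar>\<theta>\<xi> t\<bar> / 2 \<and>
               \<tau> (\<sigma> t) = k (\<sigma> t))))) \<and>
    ((\<forall>t\<in>I. k1 t = 0) \<longrightarrow> geodesic A nablat \<gamma> J)"
proof -
  note [simp] = b
  interpret F: F4_manifold3 A \<phi> \<xi> \<eta> g nabla
    using F4 by unfold_locales
  interpret C: null_slant_curve A \<phi> \<xi> \<eta> g nabla C I a nablat
    using C null slant nablat gt by unfold_locales simp_all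
  have a: "\<bar>a\<bar> > 0" "a \<noteq> 0"
    using C.slant_nonzero by auto
  \<comment> \<open>The velocity has square a^2 for the associated metric, so \<sigma> has constant
    derivative |a| and is affine. The constant \<open>r0\<close> is the free choice of origin for
    arc length.\<close>
  have "((\<lambda>t. \<sigma> t - \<bar>a\<bar> * t) has_real_derivative 0) (at t within I)" if "t \<in> I" for t
  proof -
    have "(\<sigma> has_real_derivative \<bar>a\<bar>) (at t)"
      using arc that C.gt_vel(1) gt by (simp add: arc_length_parameter_def)
    then have "((\<lambda>t. \<sigma> t - \<bar>a\<bar> * t) has_real_derivative \<bar>a\<bar> - \<bar>a\<bar> * 1) (at t)"
      by (intro DERIV_diff DERIV_cmult DERIV_ident)
    then show ?thesis
      by (simp add: has_field_derivative_at_within)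
  qed
  moreover have "convex I"
    using C.is_interval is_interval_convex by blast
  ultimately obtain r0 where r0: "\<And>t. t \<in> I \<Longrightarrow> \<sigma> t - \<bar>a\<bar> * t = r0"
    using has_field_derivative_zero_constant[of I "\<lambda>t. \<sigma> t - \<bar>a\<bar> * t"] by blast
  then have \<sigma>: "\<sigma> t = \<bar>a\<bar> * t + r0" if "t \<in> I" for t
    using that by (simp add: algebra_simps)
  have "inj_on \<sigma> I"
    using \<sigma> a by (auto simp: inj_on_def)
  then have \<gamma>_\<sigma>: "\<gamma> (\<sigma> t) = C t" if "t \<in> I" for t
    using that by (simp add: \<gamma> inv_into_f_f)
  have J': "J = (\<lambda>t. \<bar>a\<bar> * t + r0) ` I"
    using J \<sigma> by simp
  have \<gamma>': "\<gamma> (\<bar>a\<bar> * t + r0) = C t" if "t \<in> I" for t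
    using \<gamma>_\<sigma>[OF that] \<sigma>[OF that] by simp
  have smooth: "smooth_curve A \<gamma> J"
    by (rule C.affine_reparameterization(1)[OF a(1) J' \<gamma>'])
  have vel_\<gamma>: "velocity A \<gamma> (\<sigma> t) = (1 / \<bar>a\<bar>) *\<^sub>R vel t" if "t \<in> I" for t
    using C.affine_reparameterization(2)[OF a(1) J' \<gamma>' that] \<sigma>[OF that] vel by simp
  have J_cases: "P s" if "s \<in> J" "\<And>t. t \<in> I \<Longrightarrow> P (\<sigma> t)" for P s
    using that J by blast
  have sgn_a: "a / \<bar>a\<bar> = sgn a" "\<bar>sgn a\<bar> = 1"
    using a by (auto simp: sgn_real_def)
  \<comment> \<open>Rescaling the velocity by 1/|a| preserves nullness and turns the slant constants
    a and 0 into \<open>sgn a\<close> and 0. All results on unit slant curves thereby become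
    available for \<gamma>.\<close>
  have "null_curve A g \<gamma> J"
    unfolding null_curve_def
  proof (rule ballI, erule J_cases)
    fix t assume t: "t \<in> I"
    then show "g (\<gamma> (\<sigma> t)) (velocity A \<gamma> (\<sigma> t)) (velocity A \<gamma> (\<sigma> t)) = 0 \<and> velocity A \<gamma> (\<sigma> t) \<noteq> 0"
      using null a by (simp add: \<gamma>_\<sigma> vel_\<gamma> vel null_curve_def F.g_linear)
  qed
  moreover have "phi_slant_with A \<phi> \<xi> \<eta> g \<gamma> J (sgn a) 0"
    unfolding phi_slant_with_def
  proof (rule ballI, erule J_cases)
    fix t assume t: "t \<in> I"
    then show "g (\<gamma> (\<sigma> t)) (velocity A \<gamma> (\<sigma> t)) (\<xi> (\<gamma> (\<sigma> t))) = sgn a \<and>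
        \<eta> (\<gamma> (\<sigma> t)) (velocity A \<gamma> (\<sigma> t)) = sgn a \<and>
        g (\<gamma> (\<sigma> t)) (velocity A \<gamma> (\<sigma> t)) (\<phi> (\<gamma> (\<sigma> t)) (velocity A \<gamma> (\<sigma> t))) = 0"
      using sgn_a C.g_vel C.eta_vel
      by (simp add: \<gamma>_\<sigma> vel_\<gamma> vel F.g_linear F.phi_linear F.eta_linear)
  qed
  ultimately interpret G: unit_null_slant_curve A \<phi> \<xi> \<eta> g nabla \<gamma> J "sgn a" nablat
    using smooth nablat gt sgn_a by unfold_locales simp_all
  have "unit_speed A gt \<gamma> J 1"
    using G.gt_vel(1) G.unit_simps by (simp add: unit_speed_def gt)
  moreover have "phi_slant A \<phi> \<xi> \<eta> gt \<gamma> J"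
    unfolding phi_slant_def phi_slant_with_def gt
    using G.gt_vel(2,3) G.eta_vel by (intro exI[of _ "sgn a"] exI[of _ "(sgn a)\<^sup>2"]) simp
  moreover have k1_eq: "k1 t = \<theta>\<xi> t * a\<^sup>2 / 2" if "t \<in> I" for t
    using C.curvature_k1_eq[OF that] by (simp add: k1 \<theta>\<xi> F.theta_xi_def)
  have \<theta>\<xi>_eq: "\<theta>\<xi> t = F.theta_xi (\<gamma> (\<sigma> t))" if "t \<in> I" for t
    using that by (simp add: \<theta>\<xi> F.theta_xi_def \<gamma>_\<sigma>)
  moreover have "geodesic A nablat \<gamma> J" if "\<forall>t\<in>I. k1 t = 0"
    unfolding geodesic_def
  proof (rule ballI)
    fix s assume s: "s \<in> J"
    then have "F.theta_xi (\<gamma> s) = 0"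
      by (rule J_cases) (use that k1_eq \<theta>\<xi>_eq a in auto)
    then show "cov_deriv_along A nablat \<gamma> (velocity A \<gamma>) s = 0"
      by (simp add: G.cov_deriv_assoc_vel[OF s])
  qed
  moreover have "frenet_curve3 A gt nablat \<gamma> J \<and>
       (\<exists>\<epsilon>t. (\<forall>t\<in>I. \<epsilon>t = sgn (k1 t) \<and> \<epsilon>t = sgn (\<theta>\<xi> t)) \<and>
         (\<forall>\<epsilon>1 \<epsilon>2 \<epsilon>3 E1 E2 E3 k \<tau>.
            frenet_apparatus A gt nablat \<gamma> J \<epsilon>1 \<epsilon>2 \<epsilon>3 E1 E2 E3 k \<tau> \<longrightarrow>
            \<epsilon>1 = 1 \<and> \<epsilon>2 = 1 \<and> \<epsilon>3 = -1 \<and>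
            (\<forall>t\<in>I.
               E1 (\<sigma> t) = velocity A \<gamma> (\<sigma> t) \<and>
               E1 (\<sigma> t) = (1 / \<bar>a\<bar>) *\<^sub>R vel t \<and>
               E2 (\<sigma> t) = \<epsilon>t *\<^sub>R ((1 / a) *\<^sub>R \<phi> (C t) (vel t) - \<xi> (C t)) \<and>
               E2 (\<sigma> t) = \<epsilon>t *\<^sub>R (- (1 / (2 * a)) *\<^sub>R vel t - a *\<^sub>R N1 t + W1 t) \<and>
               E3 (\<sigma> t) = (1 / \<bar>a\<bar>) *\<^sub>R (\<phi> (C t) (vel t) - vel t) \<and>
               E3 (\<sigma> t) = sgn a *\<^sub>R (- (1 / a) *\<^sub>R vel t + W1 t) \<and>
               k (\<sigma> t) = \<bar>k1 t\<bar> / a\<^sup>2 \<and>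
               k (\<sigma> t) = \<bar>\<theta>\<xi> t\<bar> / 2 \<and>
               \<tau> (\<sigma> t) = k (\<sigma> t))))"
    if nongeodesic: "\<forall>t\<in>I. k1 t \<noteq> 0"
  proof -
    have nz: "F.theta_xi (\<gamma> s) \<noteq> 0" if "s \<in> J" for s
      using that by (rule J_cases) (use nongeodesic k1_eq \<theta>\<xi>_eq in auto)
    obtain s0 where s0: "s0 \<in> J"
      using G.interval_nonempty by blast
    define e where "e = sgn (F.theta_xi (\<gamma> s0))"
    have e: "F.theta_xi (\<gamma> s) \<noteq> 0 \<and> sgn (F.theta_xi (\<gamma> s)) = e" if "s \<in> J" for s
      using nz G.sgn_theta_xi_constant[OF nz that s0] that by (simp add: e_def)
    have "frenet_curve3 A gt nablat \<gamma> J"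
      unfolding frenet_curve3_def gt using G.frenet_apparatus_exists[OF e] by blast
    moreover have "e = sgn (k1 t) \<and> e = sgn (\<theta>\<xi> t)" if "t \<in> I" for t
      using e[of "\<sigma> t"] that J a G.unit_simps(1) by (simp add: k1_eq \<theta>\<xi>_eq sgn_mult)
    moreover have "\<epsilon>1 = 1 \<and> \<epsilon>2 = 1 \<and> \<epsilon>3 = -1 \<and>
            (\<forall>t\<in>I.
               E1 (\<sigma> t) = velocity A \<gamma> (\<sigma> t) \<and>
               E1 (\<sigma> t) = (1 / \<bar>a\<bar>) *\<^sub>R vel t \<and>
               E2 (\<sigma> t) = e *\<^sub>R ((1 / a) *\<^sub>R \<phi> (C t) (vel t) - \<xi> (C t)) \<and>
               E2 (\<sigma> t) = e *\<^sub>R (- (1 / (2 * a)) *\<^sub>R vel t - a *\<^sub>R N1 t + W1 t) \<and>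
               E3 (\<sigma> t) = (1 / \<bar>a\<bar>) *\<^sub>R (\<phi> (C t) (vel t) - vel t) \<and>
               E3 (\<sigma> t) = sgn a *\<^sub>R (- (1 / a) *\<^sub>R vel t + W1 t) \<and>
               k (\<sigma> t) = \<bar>k1 t\<bar> / a\<^sup>2 \<and>
               k (\<sigma> t) = \<bar>\<theta>\<xi> t\<bar> / 2 \<and>
               \<tau> (\<sigma> t) = k (\<sigma> t))"
      if fr: "frenet_apparatus A gt nablat \<gamma> J \<epsilon>1 \<epsilon>2 \<epsilon>3 E1 E2 E3 k \<tau>" for \<epsilon>1 \<epsilon>2 \<epsilon>3 E1 E2 E3 k \<tau>
    proof -
      note unique = G.frenet_apparatus_unique[OF e fr[unfolded gt]]
      show ?thesis
      proof (intro conjI ballI)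
        show "\<epsilon>1 = 1" "\<epsilon>2 = 1" "\<epsilon>3 = -1"
          using unique by blast+
        fix t assume t: "t \<in> I"
        then have "\<sigma> t \<in> J"
          using J by simp
        then have E: "E1 (\<sigma> t) = velocity A \<gamma> (\<sigma> t)" "E2 (\<sigma> t) = G.normal e (\<sigma> t)"
            "E3 (\<sigma> t) = G.binormal (\<sigma> t)" "k (\<sigma> t) = \<bar>F.theta_xi (\<gamma> (\<sigma> t))\<bar> / 2" "\<tau> (\<sigma> t) = k (\<sigma> t)"
          using unique by blast+
        have phi: "\<phi> (\<gamma> (\<sigma> t)) (velocity A \<gamma> (\<sigma> t)) = (1 / \<bar>a\<bar>) *\<^sub>R \<phi> (C t) (vel t)"
          by (simp add: \<gamma>_\<sigma> t vel_\<gamma> F.phi_linear)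
        have N1_eq: "N1 t = (1 / a) *\<^sub>R \<xi> (C t) - (1 / (2 * a\<^sup>2)) *\<^sub>R vel t"
          using C.frame_N1_eq by (simp add: N1 vel)
        have W1_eq: "W1 t = (1 / a) *\<^sub>R \<phi> (C t) (vel t)"
          using C.frame_W1_eq[of t] by (simp add: W1 vel)
        have sgn_div: "sgn a * (1 / \<bar>a\<bar>) = 1 / a" "sgn a * (1 / a) = 1 / \<bar>a\<bar>"
          using a by (auto simp: sgn_real_def)
        show "E1 (\<sigma> t) = velocity A \<gamma> (\<sigma> t)" "E1 (\<sigma> t) = (1 / \<bar>a\<bar>) *\<^sub>R vel t" "\<tau> (\<sigma> t) = k (\<sigma> t)"
          using E vel_\<gamma>[OF t] by simp_all
        \<comment> \<open>\<open>normal\<close> for \<gamma> uses the slant constant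
          \<open>sgn a\<close> and the velocity divided by |a|; their product is 1/a.\<close>
        have E2: "E2 (\<sigma> t) = e *\<^sub>R ((sgn a * (1 / \<bar>a\<bar>)) *\<^sub>R \<phi> (C t) (vel t) - \<xi> (C t))"
          unfolding E G.normal_def phi by (simp add: \<gamma>_\<sigma> t)
        then show 2: "E2 (\<sigma> t) = e *\<^sub>R ((1 / a) *\<^sub>R \<phi> (C t) (vel t) - \<xi> (C t))"
          unfolding sgn_div .
        \<comment> \<open>Since a N1 = \<xi> - v/(2a), the multiples of v cancel and W1 - \<xi>
          remains.\<close>
        have "- (1 / (2 * a)) *\<^sub>R vel t - a *\<^sub>R N1 t + W1 t = (1 / a) *\<^sub>R \<phi> (C t) (vel t) - \<xi> (C t)"
          using a(2) by (simp add: N1_eq W1_eq scaleR_diff_right power2_eq_square)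
        then show "E2 (\<sigma> t) = e *\<^sub>R (- (1 / (2 * a)) *\<^sub>R vel t - a *\<^sub>R N1 t + W1 t)"
          using 2 by simp
        show 3: "E3 (\<sigma> t) = (1 / \<bar>a\<bar>) *\<^sub>R (\<phi> (C t) (vel t) - vel t)"
          unfolding E G.binormal_def phi by (simp add: vel_\<gamma> t scaleR_diff_right)
        have "sgn a *\<^sub>R (- (1 / a) *\<^sub>R vel t + W1 t) = (sgn a * (1 / a)) *\<^sub>R (\<phi> (C t) (vel t) - vel t)"
          by (simp add: W1_eq scaleR_diff_right)
        then show "E3 (\<sigma> t) = sgn a *\<^sub>R (- (1 / a) *\<^sub>R vel t + W1 t)"
          unfolding 3 sgn_div by simp
        show "k (\<sigma> t) = \<bar>\<theta>\<xi> t\<bar> / 2"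
          using E \<theta>\<xi>_eq[OF t] by simp
        then show "k (\<sigma> t) = \<bar>k1 t\<bar> / a\<^sup>2"
          using a by (simp add: k1_eq[OF t] abs_mult)
      qed
    qed
    ultimately show ?thesis
      by (intro conjI exI[of _ e]) blast+
  qed
  ultimately show ?thesis
    using smooth by blast
qed

end
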